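(* Assume: (1) $w_0\in\mathbb R^d$ and $\epsilon_0\ge0$ satisfy $F(w_0)-F_*\le\epsilon_0$; (2) there are constants $G>0$ and $\rho\geq 0$ such that $\|\partial f(w;\xi)\|_2\le G$ and $\|\partial R(w)\|_2\le\rho$ for all $w\in\mathbb R^d$; (3) for a target accuracy $0<\epsilon<\min\{1,\epsilon_0\}$ there are $c>0$ and $\theta\in(0,1]$ such that $\|w-w_*\|_2\le c\,(F(w)-F_* )^\theta$ for all $w\in\mathcal S_\epsilon$, where $w_*$ is the minimizer of $F$ closest to $w$. Let $\delta\in(0,1)$, $K=\lceil\log_2(\epsilon_0/\epsilon)\rceil$, $\tilde\delta=\delta/K$, $D_1\ge\frac{c\epsilon_0}{\epsilon^{1-\theta}}$, and let $t$ be the smallest integer such that $$t\ \ge\ \max\left\{\max\big(16,\,3072\log(1/\tilde\delta)\big)\frac{G^2D_1^2}{\epsilon_0^2},\ \frac{8\rho D_1}{\epsilon_0}\right\}.$$ Then the output $w_K$ of ProxASSG satisfies, with probability at least $1-\delta$, $$F(w_K)-F_*\le2\epsilon .$$ Consequently, if $D_1=O\big(\frac{c\epsilon_0}{\epsilon^{1-\theta}}\big)$, the iteration complexity $Kt$ of ProxASSG for achieving a $2\epsilon$-optimal solution with probability at least $1-\delta$ is $\widetilde O\big(\log(1/\delta)/\epsilon^{2(1-\theta)}\big)$.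
   Context: Problem: $\min_{w\in\mathbb R^d}F(w)=f(w)+R(w)$ with $f(w)=\mathbb E_\xi[f(w;\xi)]$, where $f(\cdot;\xi)$ and $R$ are real-valued convex functions (possibly non-smooth). $F_*=\min F$ is attained. $\partial f(w;\xi)$ and $\partial R(w)$ denote subgradients, with $\mathbb E_\xi[\partial f(w;\xi)]$ a subgradient of $f$ at $w$. $\mathcal S_\epsilon=\{w\in\mathbb R^d:F(w)\le F_*+\epsilon\}$. For a closed ball $\Omega\subset\mathbb R^d$, $\mathrm{Prox}^{\eta,R}_\Omega[w]=\arg\min_{u\in\Omega}\frac12\|u-w\|_2^2+\eta R(u)$. $\mathcal B(w,r)$ is the closed Euclidean ball. $\log$ is the natural logarithm. Algorithm ProxASSG: inputs $K,t,w_0,D_1$, and $\eta_1=\epsilon_0/(4G^2)$. For $k=1,\dots,K$: let $w_1^k=w_{k-1}$, $\Omega_k=\mathcal B(w_{k-1},D_k)$; for $\tau=1,\dots,t$ let $w^k_{\tau+1}=\mathrm{Prox}^{\eta_k,R}_{\Omega_k}\big[w^k_\tau-\eta_k\partial f(w^k_\tau;\xi^k_\tau)\big]$ with $\xi^k_\tau$ independent copies of $\xi$; let $w_k=\frac1t\sum_{\tau=1}^tw^k_\tau$, $\eta_{k+1}=\eta_k/2$, $D_{k+1}=D_k/2$. Output $w_K$. $\widetilde O$ suppresses constants depending on the problem parameters ($c,G,\rho,\epsilon_0$ and the constant in $D_1=O(\cdot)$) and factors (poly)logarithmic in $1/\epsilon$; integer rounding and the maximum with $16$ are absorbed. *)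

theory Defs
  imports "HOL-Probability.Probability"
begin

definition subdifferential :: "('a::real_inner \<Rightarrow> real) \<Rightarrow> 'a \<Rightarrow> 'a set" where
  "subdifferential h w = {v. \<forall>u. h u \<ge> h w + v \<bullet> (u - w)}"

definition minimizers :: "('a \<Rightarrow> real) \<Rightarrow> 'a set" where
  "minimizers h = {w. is_arg_min h (\<lambda>_. True) w}"

text \<open>The infimum is only meaningful when it is attained, i.e. when \<^term>\<open>minimizers h \<noteq> {}\<close>.\<close>

definition min_value :: "('a \<Rightarrow> real) \<Rightarrow> real" where
  "min_value h = (INF w. h w)"

definition eps_sublevel :: "('a \<Rightarrow> real) \<Rightarrow> real \<Rightarrow> 'a set" where
  "eps_sublevel h \<epsilon> = {w. h w \<le> min_value h + \<epsilon>}"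

definition local_error_bound ::
    "('a::euclidean_space \<Rightarrow> real) \<Rightarrow> real \<Rightarrow> real \<Rightarrow> real \<Rightarrow> bool" where
  "local_error_bound h \<epsilon> c \<theta> \<longleftrightarrow>
     (\<forall>w\<in>eps_sublevel h \<epsilon>.
        norm (w - closest_point (minimizers h) w) \<le> c * (h w - min_value h) powr \<theta>)"

text \<open>
  The law of the random variable \<open>\<xi>\<close> is the probability measure \<open>P\<close>; \<open>f w x\<close> is the loss
  at \<open>w\<close> under the realisation \<open>x\<close> of \<open>\<xi>\<close>, and \<open>g w x\<close> is the stochastic subgradient
  returned to the algorithm.
\<close>

definition expected_loss :: "'x measure \<Rightarrow> ('a \<Rightarrow> 'x \<Rightarrow> real) \<Rightarrow> 'a \<Rightarrow> real" where
  "expected_loss P f w = (\<integral>x. f w x \<partial>P)"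

definition objective ::
    "'x measure \<Rightarrow> ('a \<Rightarrow> 'x \<Rightarrow> real) \<Rightarrow> ('a \<Rightarrow> real) \<Rightarrow> 'a \<Rightarrow> real" where
  "objective P f R w = expected_loss P f w + R w"

text \<open>
  Joint measurability of \<open>g\<close> makes the iterates random variables.
\<close>

locale stochastic_composite_problem = prob_space P
  for P :: "'x measure" +
  fixes f :: "'a::euclidean_space \<Rightarrow> 'x \<Rightarrow> real"
    and g :: "'a \<Rightarrow> 'x \<Rightarrow> 'a"
    and R :: "'a \<Rightarrow> real"
  assumes loss_convex: "\<And>x. x \<in> space P \<Longrightarrow> convex_on UNIV (\<lambda>w. f w x)"
    and loss_integrable: "\<And>w. integrable P (f w)"
    and regularizer_convex: "convex_on UNIV R"
    and minimum_attained: "minimizers (objective P f R) \<noteq> {}"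
    and subgradient_measurable: "(\<lambda>(w, x). g w x) \<in> borel_measurable (borel \<Otimes>\<^sub>M P)"
    and subgradient: "\<And>w x. x \<in> space P \<Longrightarrow> g w x \<in> subdifferential (\<lambda>u. f u x) w"
    and subgradient_integrable: "\<And>w. integrable P (g w)"
    and expected_subgradient:
      "\<And>w. (\<integral>x. g w x \<partial>P) \<in> subdifferential (expected_loss P f) w"

definition prox ::
    "real \<Rightarrow> ('a::euclidean_space \<Rightarrow> real) \<Rightarrow> 'a set \<Rightarrow> 'a \<Rightarrow> 'a" where
  "prox \<eta> R \<Omega> w = arg_min_on (\<lambda>u. 1/2 * (norm (u - w))\<^sup>2 + \<eta> * R u) \<Omega>"

text \<open>
  Inner loop of a stage started at \<open>w\<close>: the \<open>n\<close>-th term of the recursion is the iterate with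
  index \<open>\<tau> = n + 1\<close>, so that the sample \<open>s \<tau>\<close> is used in passing from \<open>\<tau>\<close> to \<open>\<tau> + 1\<close>.
\<close>

primrec stage_iterate ::
    "('a::euclidean_space \<Rightarrow> 'x \<Rightarrow> 'a) \<Rightarrow> ('a \<Rightarrow> real) \<Rightarrow> real \<Rightarrow> real \<Rightarrow> 'a \<Rightarrow> (nat \<Rightarrow> 'x)
      \<Rightarrow> nat \<Rightarrow> 'a" where
  "stage_iterate g R \<eta> D w s 0 = w"
| "stage_iterate g R \<eta> D w s (Suc n) =
     prox \<eta> R (cball w D)
       (stage_iterate g R \<eta> D w s n - \<eta> *\<^sub>R g (stage_iterate g R \<eta> D w s n) (s (Suc n)))"

definition stage_average ::
    "('a::euclidean_space \<Rightarrow> 'x \<Rightarrow> 'a) \<Rightarrow> ('a \<Rightarrow> real) \<Rightarrow> nat \<Rightarrow> real \<Rightarrow> real \<Rightarrow> 'a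
      \<Rightarrow> (nat \<Rightarrow> 'x) \<Rightarrow> 'a" where
  "stage_average g R t \<eta> D w s =
     (1 / real t) *\<^sub>R (\<Sum>\<tau>=1..t. stage_iterate g R \<eta> D w s (\<tau> - 1))"

text \<open>
  After \<open>k\<close> stages the state consists of the output \<open>w\<^sub>k\<close> together with the step size and the
  radius for stage \<open>k + 1\<close>. The value \<open>s k \<tau>\<close> is the sample used in step \<open>\<tau>\<close> of stage \<open>k\<close>.
\<close>

primrec proxASSG_state ::
    "('a::euclidean_space \<Rightarrow> 'x \<Rightarrow> 'a) \<Rightarrow> ('a \<Rightarrow> real) \<Rightarrow> nat \<Rightarrow> real \<Rightarrow> real \<Rightarrow> 'a
      \<Rightarrow> (nat \<Rightarrow> nat \<Rightarrow> 'x) \<Rightarrow> nat \<Rightarrow> 'a \<times> real \<times> real" where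
  "proxASSG_state g R t \<eta>\<^sub>1 D\<^sub>1 w\<^sub>0 s 0 = (w\<^sub>0, \<eta>\<^sub>1, D\<^sub>1)"
| "proxASSG_state g R t \<eta>\<^sub>1 D\<^sub>1 w\<^sub>0 s (Suc k) =
     (case proxASSG_state g R t \<eta>\<^sub>1 D\<^sub>1 w\<^sub>0 s k of
        (w, \<eta>, D) \<Rightarrow> (stage_average g R t \<eta> D w (s (Suc k)), \<eta> / 2, D / 2))"

definition proxASSG ::
    "('a::euclidean_space \<Rightarrow> 'x \<Rightarrow> 'a) \<Rightarrow> ('a \<Rightarrow> real) \<Rightarrow> real \<Rightarrow> real \<Rightarrow> nat \<Rightarrow> nat \<Rightarrow> 'a \<Rightarrow> real
      \<Rightarrow> (nat \<Rightarrow> nat \<Rightarrow> 'x) \<Rightarrow> 'a" where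
  "proxASSG g R G \<epsilon>\<^sub>0 K t w\<^sub>0 D\<^sub>1 s =
     fst (proxASSG_state g R t (\<epsilon>\<^sub>0 / (4 * G\<^sup>2)) D\<^sub>1 w\<^sub>0 s K)"

definition stage_count :: "real \<Rightarrow> real \<Rightarrow> nat" where
  "stage_count \<epsilon>\<^sub>0 \<epsilon> = nat \<lceil>log 2 (\<epsilon>\<^sub>0 / \<epsilon>)\<rceil>"

text \<open>The lower bound on \<open>n\<close> is nonnegative, so the least natural number is the least integer.\<close>

definition stage_length :: "real \<Rightarrow> real \<Rightarrow> real \<Rightarrow> real \<Rightarrow> real \<Rightarrow> nat" where
  "stage_length G \<rho> \<epsilon>\<^sub>0 D\<^sub>1 \<delta>' =
     (LEAST n. real n \<ge> max (max 16 (3072 * ln (1 / \<delta>')) * (G\<^sup>2 * D\<^sub>1\<^sup>2 / \<epsilon>\<^sub>0\<^sup>2)) (8 * \<rho> * D\<^sub>1 / \<epsilon>\<^sub>0))"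

text \<open>The array \<open>\<xi>\<close> consists of independent random variables on \<open>M\<close>, each with law \<open>P\<close>.\<close>

definition iid_samples ::
    "'m measure \<Rightarrow> 'x measure \<Rightarrow> nat \<Rightarrow> nat \<Rightarrow> (nat \<Rightarrow> nat \<Rightarrow> 'm \<Rightarrow> 'x) \<Rightarrow> bool" where
  "iid_samples M P K t \<xi> \<longleftrightarrow>
     prob_space M \<and>
     prob_space.indep_vars M (\<lambda>_. P) (\<lambda>(k, \<tau>). \<xi> k \<tau>) ({1..K} \<times> {1..t}) \<and>
     (\<forall>k\<in>{1..K}. \<forall>\<tau>\<in>{1..t}. distr M P (\<xi> k \<tau>) = P)"

end

theory Submission
  imports Defs
begin

text \<open>
  Write \<open>F\<close> for the objective, \<open>F\<^sub>*\<close> for its minimum, \<open>e = \<epsilon>\<^sub>0 / 2 ^ k\<close> and \<open>D = D\<^sub>1 / 2 ^ k\<close> for the accuracy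
  and the radius with which stage \<open>k + 1\<close> starts. The invariant is
  \<open>F w\<^sub>k - F\<^sub>* \<le> \<epsilon> + e\<close>. At the start it holds because \<open>F w\<^sub>0 - F\<^sub>* \<le> \<epsilon>\<^sub>0\<close>, and after \<open>K\<close> stages, when
  \<open>\<epsilon>\<^sub>0 / 2 ^ K \<le> \<epsilon>\<close>, it is the conclusion. One stage preserves it except with probability
  \<open>\<delta> / K\<close>, so that a union bound gives total failure probability \<open>\<delta>\<close>.

  The error bound enters through geometry (\<open>error_bound_distance_to_sublevel\<close>). It is only known on
  the \<open>\<epsilon>\<close>-sublevel set, but \<open>F\<close> is convex: on the segment from \<open>w\<close> to its nearest minimizer there is a
  point \<open>u\<close> with \<open>F u - F\<^sub>* \<le> \<epsilon>\<close> that divides the segment in a known ratio, namely that of \<open>\<epsilon>\<close> to the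
  gap at \<open>w\<close>. The error bound at \<open>u\<close> therefore controls the length of the whole segment. Hence a \<open>w\<close>
  satisfying the invariant has such a comparison point \<open>u\<close> at distance at most \<open>c e / \<epsilon> powr (1 - \<theta>) \<le> D\<close>. The ball of the stage
  therefore contains a point that is good to within \<open>\<epsilon>\<close>, and it suffices that the stage reaches
  \<open>F u + e / 2\<close>.

  Within a stage, the regret against \<open>u\<close> of proximal subgradient steps is at most
  \<open>D\<^sup>2 / (2 \<eta>) + t \<eta> G\<^sup>2 / 2 + \<rho> D\<close> (\<open>stage_regret\<close>); by convexity, and with expected in place of
  sampled subgradients, the regret divided by \<open>t\<close> dominates the gap between the average iterate and \<open>u\<close>. The
  replacement of expected by sampled subgradients costs a sum of martingale differences, each at most
  \<open>4 G D\<close> in absolute value since all iterates stay in the ball; the Azuma-Hoeffding inequality bounds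
  it. For \<open>\<eta> = e / (4 G\<^sup>2)\<close> and the prescribed \<open>t\<close> each of the four contributions is at most
  \<open>e / 8\<close> (\<open>stage_high_probability\<close>). Since \<open>t\<close> depends on \<open>D\<close> and \<open>e\<close> through \<open>D / e\<close> only, one value of
  \<open>t\<close> serves all stages.

  The start \<open>w\<^sub>k\<close> of a stage is itself random, but independent of the samples of the stage, so the bound
  for a deterministic start can be integrated over the law of \<open>w\<^sub>k\<close>. This requires a stage to be
  jointly measurable in start and samples, hence the proximal map to depend measurably on the
  centre of its ball as well; it is even jointly continuous (\<open>continuous_on_prox\<close>).
\<close>

section \<open>Subgradients of finite convex functions\<close>

text \<open>
  The strict epigraph is convex and does not contain \<open>(w, h w)\<close>. A hyperplane separating the two is not
  vertical because \<open>h\<close> is finite everywhere, and its slope is a subgradient.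
\<close>

lemma convex_has_subgradient:
  fixes h :: "'a::euclidean_space \<Rightarrow> real"
  assumes "convex_on UNIV h"
  obtains v where "v \<in> subdifferential h w"
proof -
  have cont: "continuous_on UNIV h"
    using assms by (intro convex_on_continuous) auto
  have "\<exists>a b. a \<noteq> 0 \<and> (\<forall>x\<in>{(w, h w)}. a \<bullet> x \<le> b) \<and> (\<forall>x\<in>{(y, s). h y < s}. a \<bullet> x \<ge> b)"
  proof (rule separating_hyperplane_sets)
    show "convex {(y, s). h y < s}"
    proof (rule convexI)
      fix p q :: "'a \<times> real" and u v :: real
      assume p: "p \<in> {(y, s). h y < s}" and q: "q \<in> {(y, s). h y < s}"
        and uv: "0 \<le> u" "0 \<le> v" "u + v = 1"
      have "h (u *\<^sub>R fst p + v *\<^sub>R fst q) \<le> u * h (fst p) + v * h (fst q)"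
        using assms uv by (auto simp: convex_on_def)
      also have "\<dots> < u * snd p + v * snd q"
      proof (cases "u = 0")
        case True
        then show ?thesis using q uv by auto
      next
        case False
        then have "u * h (fst p) < u * snd p" "v * h (fst q) \<le> v * snd q"
          using p q uv by (auto intro!: mult_left_mono)
        then show ?thesis by linarith
      qed
      finally show "u *\<^sub>R p + v *\<^sub>R q \<in> {(y, s). h y < s}"
        by (auto simp: case_prod_beta)
    qed
    show "{(y, s). h y < s} \<noteq> {}"
      by (auto intro!: exI[of _ "(h w + 1)"] exI[of _ w])
  qed auto
  then obtain a b where "a \<noteq> 0" and ab: "a \<bullet> (w, h w) \<le> b"
    "\<And>y s. h y < s \<Longrightarrow> a \<bullet> (y, s) \<ge> b" by auto
  obtain a1 a2 where a: "a = (a1, a2)" by (cases a)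
  have sep: "a1 \<bullet> w + a2 * h w \<le> a1 \<bullet> y + a2 * s" if "h y < s" for y s
    using ab(1) ab(2)[OF that] by (simp add: a)
  have "0 \<le> a2" using sep[of w "h w + 1"] by (simp add: algebra_simps)
  \<comment> \<open>A vertical hyperplane through w would leave points of the strict epigraph on both sides.\<close>
  have "a2 \<noteq> 0"
  proof
    assume "a2 = 0"
    then have "0 \<le> a1 \<bullet> (- a1)"
      using sep[of "w - a1" "h (w - a1) + 1"] by (simp add: algebra_simps)
    then have "a1 = 0" by simp (metis inner_gt_zero_iff not_le)
    with \<open>a2 = 0\<close> \<open>a \<noteq> 0\<close> a show False by (simp add: zero_prod_def)
  qed
  with \<open>0 \<le> a2\<close> have "a2 > 0" by simp
  have le: "a1 \<bullet> w + a2 * h w \<le> a1 \<bullet> y + a2 * h y" for y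
  proof (rule field_le_epsilon)
    fix e :: real assume "e > 0"
    then show "a1 \<bullet> w + a2 * h w \<le> a1 \<bullet> y + a2 * h y + e"
      using sep[of y "h y + e / a2"] \<open>a2 > 0\<close> by (simp add: algebra_simps)
  qed
  \<comment> \<open>Normalise the normal vector of the hyperplane to last component 1.\<close>
  have "(- (1 / a2)) *\<^sub>R a1 \<in> subdifferential h w"
    unfolding subdifferential_def
  proof safe
    fix y
    have "a2 * (h w + (- (1 / a2) *\<^sub>R a1) \<bullet> (y - w)) = a2 * h w - (a1 \<bullet> y - a1 \<bullet> w)"
      using \<open>a2 > 0\<close> by (simp add: field_simps inner_diff_right)
    also have "\<dots> \<le> a2 * h y" using le[of y] by simp
    finally show "h w + (- (1 / a2) *\<^sub>R a1) \<bullet> (y - w) \<le> h y"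
      using \<open>a2 > 0\<close> by simp
  qed
  then show thesis by (rule that)
qed

text \<open>
  This is how the bound on the subgradients of the regularizer is used: it limits the oscillation of
  the regularizer over the ball of a stage.
\<close>

lemma lipschitz_if_subgradients_bounded:
  fixes h :: "'a::euclidean_space \<Rightarrow> real"
  assumes "convex_on UNIV h" and "\<And>w v. v \<in> subdifferential h w \<Longrightarrow> norm v \<le> \<rho>"
  shows "h w - h u \<le> \<rho> * norm (w - u)"
proof -
  obtain v where v: "v \<in> subdifferential h w"
    using convex_has_subgradient[OF assms(1)] .
  then have "h w - h u \<le> v \<bullet> (w - u)"
    by (auto simp: subdifferential_def inner_diff_right dest: spec[of _ u])
  also have "\<dots> \<le> norm v * norm (w - u)" by (rule norm_cauchy_schwarz)
  also have "\<dots> \<le> \<rho> * norm (w - u)"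
    using assms(2)[OF v] by (rule mult_right_mono) simp
  finally show ?thesis .
qed

section \<open>The proximal step\<close>

lemma prox_minimizes:
  fixes R :: "'a::euclidean_space \<Rightarrow> real"
  assumes "convex_on UNIV R" "0 \<le> D"
  shows "prox \<eta> R (cball w D) a \<in> cball w D"
    and "\<And>v. v \<in> cball w D \<Longrightarrow>
      1/2 * (norm (prox \<eta> R (cball w D) a - a))\<^sup>2 + \<eta> * R (prox \<eta> R (cball w D) a)
      \<le> 1/2 * (norm (v - a))\<^sup>2 + \<eta> * R v"
proof -
  let ?\<phi> = "\<lambda>u. 1/2 * (norm (u - a))\<^sup>2 + \<eta> * R u"
  have "continuous_on UNIV R"
    using assms by (intro convex_on_continuous) auto
  then have "continuous_on (cball w D) R" by (rule continuous_on_subset) simp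
  then have "continuous_on (cball w D) ?\<phi>" by (intro continuous_intros)
  then have "\<exists>x\<in>cball w D. \<forall>y\<in>cball w D. ?\<phi> x \<le> ?\<phi> y"
    using \<open>0 \<le> D\<close> by (intro continuous_attains_inf) auto
  then have "\<exists>x. is_arg_min ?\<phi> (\<lambda>u. u \<in> cball w D) x"
    by (auto simp: is_arg_min_linorder)
  then have "is_arg_min ?\<phi> (\<lambda>u. u \<in> cball w D) (prox \<eta> R (cball w D) a)"
    unfolding prox_def arg_min_on_def arg_min_def by (rule someI_ex)
  then show "prox \<eta> R (cball w D) a \<in> cball w D"
    "\<And>v. v \<in> cball w D \<Longrightarrow> ?\<phi> (prox \<eta> R (cball w D) a) \<le> ?\<phi> v"
    unfolding is_arg_min_linorder by blast+
qed

text \<open>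
  The objective of the proximal step is \<open>1\<close>-strongly convex, so it exceeds its minimum over the ball at
  least by half the squared distance to the minimizer.
\<close>

lemma prox_three_point:
  fixes R :: "'a::euclidean_space \<Rightarrow> real" and a :: 'a
  assumes R: "convex_on UNIV R" and "0 \<le> D" "0 \<le> \<eta>" and v: "v \<in> cball w D"
  defines "p \<equiv> prox \<eta> R (cball w D) a"
  shows "1/2 * (norm (p - a))\<^sup>2 + \<eta> * R p + 1/2 * (norm (v - p))\<^sup>2
    \<le> 1/2 * (norm (v - a))\<^sup>2 + \<eta> * R v"
proof -
  let ?\<phi> = "\<lambda>u. 1/2 * (norm (u - a))\<^sup>2 + \<eta> * R u"
  have p: "p \<in> cball w D" and min: "\<And>v. v \<in> cball w D \<Longrightarrow> ?\<phi> p \<le> ?\<phi> v"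
    using prox_minimizes[OF R \<open>0 \<le> D\<close>] unfolding p_def by auto
  \<comment> \<open>Compare p with the point at fraction 1 - z of the way to v; the claim is the limit of z to 1.\<close>
  have "z * (1/2 * (norm (v - p))\<^sup>2) \<le> ?\<phi> v - ?\<phi> p" if z: "0 < z" "z < 1" for z
  proof -
    define s where "s = 1 - z"
    have s: "0 < s" "s < 1" "z = 1 - s" using z by (auto simp: s_def)
    have "(1 - s) *\<^sub>R p + s *\<^sub>R v \<in> cball w D"
      using p v s by (intro convexD[OF convex_cball]) auto
    then have "?\<phi> p \<le> ?\<phi> ((1 - s) *\<^sub>R p + s *\<^sub>R v)" by (rule min)
    moreover have "\<eta> * R ((1 - s) *\<^sub>R p + s *\<^sub>R v) \<le> \<eta> * ((1 - s) * R p + s * R v)"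
      using R s \<open>0 \<le> \<eta>\<close> by (intro mult_left_mono) (auto simp: convex_on_def)
    moreover have "(norm ((1 - s) *\<^sub>R p + s *\<^sub>R v - a))\<^sup>2 =
      (1 - s) * (norm (p - a))\<^sup>2 + s * (norm (v - a))\<^sup>2 - s * (1 - s) * (norm (v - p))\<^sup>2"
      unfolding power2_norm_eq_inner
      by (simp add: algebra_simps inner_commute)
    ultimately have "s * (z * (1/2 * (norm (v - p))\<^sup>2)) \<le> s * (?\<phi> v - ?\<phi> p)"
      unfolding s(3) by (simp add: algebra_simps diff_divide_distrib add_divide_distrib)
    then show ?thesis using s by simp
  qed
  then have "1/2 * (norm (v - p))\<^sup>2 \<le> ?\<phi> v - ?\<phi> p"
    by (rule field_le_mult_one_interval)
  then show ?thesis by simp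
qed

text \<open>
  Moving the ball together with its centre makes the feasible set of the offsets \<open>v\<close> constant. The
  offsets for two centres are then admissible competitors for each other, and adding the two
  three-point inequalities leaves only the change of the regularizer under the shift of the centre
  and a term linear in the change of \<open>w - a\<close>.
\<close>

lemma prox_offset_holder:
  fixes R :: "'a::euclidean_space \<Rightarrow> real" and a a' w w' :: 'a
  assumes R: "convex_on UNIV R" and D: "0 \<le> D" and eta: "0 \<le> \<eta>"
    and lip: "\<And>x y. R x - R y \<le> \<rho> * norm (x - y)"
  defines "v \<equiv> prox \<eta> R (cball w D) a - w" and "v' \<equiv> prox \<eta> R (cball w' D) a' - w'"
  shows "(norm (v - v'))\<^sup>2 \<le> 2 * \<eta> * \<rho> * norm (w - w') + 2 * D * norm ((w - a) - (w' - a'))"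
proof -
  let ?b = "w - a" and ?b' = "w' - a'"
  have v: "norm v \<le> D" and v': "norm v' \<le> D"
    using prox_minimizes(1)[OF R D, of \<eta> w a] prox_minimizes(1)[OF R D, of \<eta> w' a']
    by (auto simp: v_def v'_def dist_norm norm_minus_commute)
  have 1: "1/2 * (norm (v + ?b))\<^sup>2 + \<eta> * R (w + v) + 1/2 * (norm (v' - v))\<^sup>2
      \<le> 1/2 * (norm (v' + ?b))\<^sup>2 + \<eta> * R (w + v')"
    using prox_three_point[OF R D eta, of "w + v'" w a] v'
    by (simp add: v_def dist_norm algebra_simps)
  have 2: "1/2 * (norm (v' + ?b'))\<^sup>2 + \<eta> * R (w' + v') + 1/2 * (norm (v - v'))\<^sup>2
      \<le> 1/2 * (norm (v + ?b'))\<^sup>2 + \<eta> * R (w' + v)"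
    using prox_three_point[OF R D eta, of "w' + v" w' a'] v
    by (simp add: v'_def dist_norm algebra_simps)
  have quad: "1/2 * (norm (v' + ?b))\<^sup>2 - 1/2 * (norm (v + ?b))\<^sup>2
      + (1/2 * (norm (v + ?b'))\<^sup>2 - 1/2 * (norm (v' + ?b'))\<^sup>2) = (v' - v) \<bullet> (?b - ?b')"
    unfolding power2_norm_eq_inner by (simp add: algebra_simps inner_commute)
  have "(v' - v) \<bullet> (?b - ?b') \<le> norm (v' - v) * norm (?b - ?b')"
    by (rule norm_cauchy_schwarz)
  also have "norm (v' - v) \<le> 2 * D"
    using norm_triangle_ineq4[of v' v] v v' by simp
  finally have cs: "(v' - v) \<bullet> (?b - ?b') \<le> 2 * D * norm (?b - ?b')"
    by (simp add: mult_right_mono)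
  have "R (w + v') - R (w' + v') \<le> \<rho> * norm (w - w')"
    and "R (w' + v) - R (w + v) \<le> \<rho> * norm (w - w')"
    using lip[of "w + v'" "w' + v'"] lip[of "w' + v" "w + v"]
    by (simp_all add: norm_minus_commute)
  then have "\<eta> * (R (w + v') - R (w' + v') + (R (w' + v) - R (w + v)))
      \<le> \<eta> * (\<rho> * norm (w - w') + \<rho> * norm (w - w'))"
    using eta by (intro mult_left_mono add_mono)
  then have "\<eta> * R (w + v') - \<eta> * R (w' + v') + (\<eta> * R (w' + v) - \<eta> * R (w + v))
      \<le> 2 * \<eta> * \<rho> * norm (w - w')"
    by (simp add: algebra_simps)
  with 1 2 quad cs show ?thesis
    by (simp add: norm_minus_commute)
qed

lemma continuous_on_prox:
  fixes R :: "'a::euclidean_space \<Rightarrow> real"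
  assumes R: "convex_on UNIV R" and D: "0 \<le> D" and eta: "0 \<le> \<eta>"
    and lip: "\<And>x y. R x - R y \<le> \<rho> * norm (x - y)"
  shows "continuous_on UNIV (\<lambda>(w, a). prox \<eta> R (cball w D) a)"
proof -
  let ?v = "\<lambda>z. prox \<eta> R (cball (fst z) D) (snd z) - fst z"
  have "(?v \<longlongrightarrow> ?v z) (at z)" for z :: "'a \<times> 'a"
  proof -
    let ?m = "\<lambda>x. 2 * \<eta> * \<rho> * norm (fst x - fst z)
      + 2 * D * norm ((fst x - snd x) - (fst z - snd z))"
    have "((\<lambda>x. sqrt (?m x)) \<longlongrightarrow> sqrt (?m z)) (at z)"
      by (intro tendsto_intros)
    then have "((\<lambda>x. sqrt (?m x)) \<longlongrightarrow> 0) (at z)" by simp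
    then have "((\<lambda>x. ?v x - ?v z) \<longlongrightarrow> 0) (at z)"
      by (rule Lim_null_comparison[rotated])
        (intro always_eventually allI real_le_rsqrt prox_offset_holder[OF R D eta lip])
    then show ?thesis by (rule LIM_zero_cancel)
  qed
  then have "continuous_on UNIV ?v"
    by (simp add: continuous_on_def)
  then have "continuous_on UNIV (\<lambda>z. ?v z + fst z)" by (rule continuous_on_add) (intro continuous_intros)
  then show ?thesis by (simp add: case_prod_beta)
qed

section \<open>The iterates of one stage\<close>

lemma stage_iterate_cong:
  assumes "\<And>\<tau>. \<tau> \<in> {1..n} \<Longrightarrow> s \<tau> = s' \<tau>"
  shows "stage_iterate g R \<eta> D w s n = stage_iterate g R \<eta> D w s' n"
  using assms by (induction n) auto

lemma stage_average_cong:
  assumes "\<And>\<tau>. \<tau> \<in> {1..t} \<Longrightarrow> s \<tau> = s' \<tau>"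
  shows "stage_average g R t \<eta> D w s = stage_average g R t \<eta> D w s'"
  unfolding stage_average_def
  by (intro arg_cong2[where f=scaleR] sum.cong refl stage_iterate_cong assms) auto

lemma stage_average_eq:
  "stage_average g R t \<eta> D w s = (1 / real t) *\<^sub>R (\<Sum>n<t. stage_iterate g R \<eta> D w s n)"
proof -
  have "(\<Sum>\<tau>=1..t. stage_iterate g R \<eta> D w s (\<tau> - 1)) = (\<Sum>n<t. stage_iterate g R \<eta> D w s n)"
    by (rule sum.reindex_bij_witness[of _ Suc "\<lambda>n. n - 1"]) auto
  then show ?thesis by (simp add: stage_average_def)
qed

lemma stage_iterate_in_cball:
  fixes R :: "'a::euclidean_space \<Rightarrow> real"
  assumes "convex_on UNIV R" "0 \<le> D"
  shows "stage_iterate g R \<eta> D w s n \<in> cball w D"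
  using assms by (cases n) (auto simp del: mem_cball intro!: prox_minimizes(1) simp: centre_in_cball)

lemma stage_iterate_measurable:
  fixes R :: "'a::euclidean_space \<Rightarrow> real"
  assumes R: "convex_on UNIV R" and D: "0 \<le> D" and eta: "0 \<le> \<eta>"
    and lip: "\<And>x y. R x - R y \<le> \<rho> * norm (x - y)"
    and g[measurable]: "(\<lambda>(w, x). g w x) \<in> borel_measurable (borel \<Otimes>\<^sub>M P)"
  shows "{1..n} \<subseteq> I \<Longrightarrow>
    (\<lambda>(w, s). stage_iterate g R \<eta> D w s n) \<in> borel_measurable (borel \<Otimes>\<^sub>M PiM I (\<lambda>_. P))"
proof (induction n)
  case 0
  then show ?case by simp
next
  case (Suc n)
  then have [measurable]:
    "(\<lambda>(w, s). stage_iterate g R \<eta> D w s n) \<in> borel_measurable (borel \<Otimes>\<^sub>M PiM I (\<lambda>_. P))"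
    using atLeastatMost_subset_iff[of 1 n 1 "Suc n"] by (intro Suc.IH) auto
  have [measurable]: "Suc n \<in> I" using Suc.prems by auto
  have prox[measurable]: "(\<lambda>(w, a). prox \<eta> R (cball w D) a) \<in> borel_measurable (borel \<Otimes>\<^sub>M borel)"
    unfolding borel_prod
    by (rule borel_measurable_continuous_onI) (rule continuous_on_prox[OF R D eta lip])
  show ?case
    unfolding stage_iterate.simps by measurable
qed

lemma stage_average_measurable:
  fixes R :: "'a::euclidean_space \<Rightarrow> real"
  assumes R: "convex_on UNIV R" and D: "0 \<le> D" and eta: "0 \<le> \<eta>"
    and lip: "\<And>x y. R x - R y \<le> \<rho> * norm (x - y)"
    and g: "(\<lambda>(w, x). g w x) \<in> borel_measurable (borel \<Otimes>\<^sub>M P)"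
  shows "(\<lambda>(w, s). stage_average g R t \<eta> D w s) \<in> borel_measurable (borel \<Otimes>\<^sub>M PiM {1..t} (\<lambda>_. P))"
proof -
  have "(\<lambda>z. stage_iterate g R \<eta> D (fst z) (snd z) n)
      \<in> borel_measurable (borel \<Otimes>\<^sub>M PiM {1..t} (\<lambda>_. P))" if "n < t" for n
    using stage_iterate_measurable[OF R D eta lip g, of n "{1..t}"] that
    by (simp add: case_prod_beta)
  then show ?thesis
    unfolding stage_average_eq case_prod_beta by (intro borel_measurable_scaleR borel_measurable_sum) auto
qed

lemma stage_iterate_measurable_fixed_start:
  fixes R :: "'a::euclidean_space \<Rightarrow> real"
  assumes "convex_on UNIV R" "0 \<le> D" "0 \<le> \<eta>" "\<And>x y. R x - R y \<le> \<rho> * norm (x - y)"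
    and "(\<lambda>(w, x). g w x) \<in> borel_measurable (borel \<Otimes>\<^sub>M P)" "{1..n} \<subseteq> I"
  shows "(\<lambda>s. stage_iterate g R \<eta> D w s n) \<in> borel_measurable (PiM I (\<lambda>_. P))"
  using measurable_compose[OF measurable_Pair1' stage_iterate_measurable[OF assms]] by simp

lemma stage_average_measurable_fixed_start:
  fixes R :: "'a::euclidean_space \<Rightarrow> real"
  assumes "convex_on UNIV R" "0 \<le> D" "0 \<le> \<eta>" "\<And>x y. R x - R y \<le> \<rho> * norm (x - y)"
    and "(\<lambda>(w, x). g w x) \<in> borel_measurable (borel \<Otimes>\<^sub>M P)"
  shows "stage_average g R t \<eta> D w \<in> borel_measurable (PiM {1..t} (\<lambda>_. P))"
  using measurable_compose[OF measurable_Pair1' stage_average_measurable[OF assms]] by simp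

text \<open>
  Apply the three-point inequality at the comparison point \<open>u\<close> and complete the square: the part
  \<open>- \<eta> d \<bullet> (p - y) - (norm (p - y))\<^sup>2 / 2\<close> is at most \<open>\<eta>\<^sup>2 (norm d)\<^sup>2 / 2\<close>.
\<close>

lemma prox_step:
  fixes R :: "'a::euclidean_space \<Rightarrow> real" and y d :: 'a
  assumes R: "convex_on UNIV R" and D: "0 \<le> D" and eta: "0 < \<eta>"
    and u: "u \<in> cball w D" and d: "norm d \<le> G"
  defines "p \<equiv> prox \<eta> R (cball w D) (y - \<eta> *\<^sub>R d)"
  shows "d \<bullet> (y - u) + R p - R u \<le> ((norm (y - u))\<^sup>2 - (norm (p - u))\<^sup>2) / (2 * \<eta>) + \<eta> * G\<^sup>2 / 2"
proof -
  have three: "1/2 * (norm (p - (y - \<eta> *\<^sub>R d)))\<^sup>2 + \<eta> * R p + 1/2 * (norm (u - p))\<^sup>2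
      \<le> 1/2 * (norm (u - (y - \<eta> *\<^sub>R d)))\<^sup>2 + \<eta> * R u"
    unfolding p_def using prox_three_point[OF R D _ u] eta by simp
  have "0 \<le> (norm (p - y + \<eta> *\<^sub>R d))\<^sup>2" by simp
  moreover have "(norm (\<eta> *\<^sub>R d))\<^sup>2 \<le> \<eta>\<^sup>2 * G\<^sup>2"
    using eta d by (simp add: power_mult_distrib power_mono)
  ultimately have "2 * \<eta> * (d \<bullet> (y - u) + R p - R u)
      \<le> (norm (y - u))\<^sup>2 - (norm (p - u))\<^sup>2 + \<eta>\<^sup>2 * G\<^sup>2"
    using three unfolding power2_norm_eq_inner
    by (simp add: algebra_simps inner_commute)
  then show ?thesis using eta by (simp add: field_simps power2_eq_square)
qed

text \<open>
  In the sum over the steps the distances to \<open>u\<close> telescope. A step bounds the regularizer at its new point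
  whereas the sum has it at the old one; this shift by one index leaves the difference of the
  regularizer between the first and the last iterate, which lie in a common ball, and produces the
  term \<open>\<rho> D\<close>.
\<close>

lemma stage_regret:
  fixes R :: "'a::euclidean_space \<Rightarrow> real"
  assumes R: "convex_on UNIV R" and D: "0 \<le> D" and eta: "0 < \<eta>"
    and lip: "\<And>x y. R x - R y \<le> \<rho> * norm (x - y)" and rho: "0 \<le> \<rho>"
    and u: "u \<in> cball w D" and g: "\<And>v \<tau>. \<tau> \<in> {1..t} \<Longrightarrow> norm (g v (s \<tau>)) \<le> G"
  defines "y \<equiv> stage_iterate g R \<eta> D w s"
  shows "(\<Sum>n<t. g (y n) (s (Suc n)) \<bullet> (y n - u) + R (y n) - R u)
    \<le> D\<^sup>2 / (2 * \<eta>) + real t * (\<eta> * G\<^sup>2 / 2) + \<rho> * D"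
proof -
  have "(\<Sum>n<m. g (y n) (s (Suc n)) \<bullet> (y n - u) + R (y n) - R u)
      \<le> ((norm (w - u))\<^sup>2 - (norm (y m - u))\<^sup>2) / (2 * \<eta>) + real m * (\<eta> * G\<^sup>2 / 2)
        + (R w - R (y m))" if "m \<le> t" for m
    using that
  proof (induction m)
    case 0
    then show ?case by (simp add: y_def)
  next
    case (Suc m)
    have "g (y m) (s (Suc m)) \<bullet> (y m - u) + R (y (Suc m)) - R u
      \<le> ((norm (y m - u))\<^sup>2 - (norm (y (Suc m) - u))\<^sup>2) / (2 * \<eta>) + \<eta> * G\<^sup>2 / 2"
      using prox_step[OF R D eta u g[of "Suc m" "y m"]] Suc.prems by (simp add: y_def)
    then show ?case using Suc by (simp add: algebra_simps diff_divide_distrib add_divide_distrib)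
  qed
  then have "(\<Sum>n<t. g (y n) (s (Suc n)) \<bullet> (y n - u) + R (y n) - R u)
      \<le> ((norm (w - u))\<^sup>2 - (norm (y t - u))\<^sup>2) / (2 * \<eta>) + real t * (\<eta> * G\<^sup>2 / 2)
        + (R w - R (y t))" by simp
  also have "((norm (w - u))\<^sup>2 - (norm (y t - u))\<^sup>2) / (2 * \<eta>) \<le> D\<^sup>2 / (2 * \<eta>)"
  proof (rule divide_right_mono)
    have "(norm (w - u))\<^sup>2 \<le> D\<^sup>2"
      using u by (intro power_mono) (auto simp: dist_norm)
    then show "(norm (w - u))\<^sup>2 - (norm (y t - u))\<^sup>2 \<le> D\<^sup>2"
      by (smt (verit) zero_le_power2)
  qed (use eta in simp)
  also have "R w - R (y t) \<le> \<rho> * D"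
  proof -
    have "norm (w - y t) \<le> D"
      using stage_iterate_in_cball[OF R D, of g \<eta> w s t] by (simp add: y_def dist_norm)
    then show ?thesis using lip[of w "y t"] rho
      by (smt (verit) mult_left_mono)
  qed
  finally show ?thesis by simp
qed

section \<open>Concentration for adapted sums of independent samples\<close>

lemma (in prob_space) exp_moment_centred_bounded:
  fixes X :: "'a \<Rightarrow> real"
  assumes X: "X \<in> borel_measurable M" and bd: "\<And>x. x \<in> space M \<Longrightarrow> \<bar>X x\<bar> \<le> b"
    and mean: "expectation X = 0" and l: "0 < l"
  shows "(\<integral>\<^sup>+x. ennreal (exp (l * X x)) \<partial>M) \<le> ennreal (exp (l\<^sup>2 * b\<^sup>2 / 2))"
proof -
  interpret interval_bounded_random_variable M X "-b" b
    by unfold_locales (use X bd in \<open>auto intro!: AE_I2 simp: abs_le_iff minus_le_iff\<close>)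
  show ?thesis
    using Hoeffdings_lemma_nn_integral_0[OF l mean] by (simp add: power2_eq_square mult_ac)
qed

text \<open>
  The increment \<open>X n s x\<close> depends on the past samples \<open>s 1, \<dots>, s n\<close> and on the new sample \<open>x\<close>, and has mean zero in \<open>x\<close>.
  Integrating out the last coordinate of the product measure first therefore
  multiplies the exponential moment by at most one Hoeffding factor.
\<close>

lemma (in prob_space) martingale_exp_moment:
  fixes X :: "nat \<Rightarrow> (nat \<Rightarrow> 'a) \<Rightarrow> 'a \<Rightarrow> real"
  assumes meas: "\<And>n. n < t \<Longrightarrow>
      (\<lambda>(s, x). X n s x) \<in> borel_measurable (PiM {1..n} (\<lambda>_. M) \<Otimes>\<^sub>M M)"
    and past: "\<And>n s s' x. (\<And>\<tau>. \<tau> \<in> {1..n} \<Longrightarrow> s \<tau> = s' \<tau>) \<Longrightarrow> X n s x = X n s' x"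
    and bd: "\<And>n s x. n < t \<Longrightarrow> s \<in> space (PiM {1..n} (\<lambda>_. M)) \<Longrightarrow> x \<in> space M \<Longrightarrow> \<bar>X n s x\<bar> \<le> b"
    and mean: "\<And>n s. n < t \<Longrightarrow> s \<in> space (PiM {1..n} (\<lambda>_. M)) \<Longrightarrow> expectation (X n s) = 0"
    and l: "0 < l"
  shows "m \<le> t \<Longrightarrow> (\<lambda>s. \<Sum>n<m. X n s (s (Suc n))) \<in> borel_measurable (PiM {1..m} (\<lambda>_. M))"
    and "m \<le> t \<Longrightarrow> (\<integral>\<^sup>+s. ennreal (exp (l * (\<Sum>n<m. X n s (s (Suc n))))) \<partial>PiM {1..m} (\<lambda>_. M))
      \<le> ennreal (exp (real m * (l\<^sup>2 * b\<^sup>2 / 2)))"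
proof -
  have sum_meas: "(\<lambda>s. \<Sum>n<m. X n s (s (Suc n))) \<in> borel_measurable (PiM {1..m} (\<lambda>_. M))"
    if "m \<le> t" for m
  proof (rule borel_measurable_sum)
    fix n assume "n \<in> {..<m}"
    then have [measurable]: "Suc n \<in> {1..m}" and sub: "{1..n} \<subseteq> {1..m}" and "n < t"
      using that by auto
    note [measurable] = meas[OF \<open>n < t\<close>] measurable_restrict_subset[OF sub]
    have "(\<lambda>s. (\<lambda>(s, x). X n s x) (restrict s {1..n}, s (Suc n))) \<in> borel_measurable (PiM {1..m} (\<lambda>_. M))"
      by measurable
    moreover have "X n (restrict s {1..n}) x = X n s x" for s x
      by (rule past) auto
    ultimately show "(\<lambda>s. X n s (s (Suc n))) \<in> borel_measurable (PiM {1..m} (\<lambda>_. M))"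
      by simp
  qed
  then show "m \<le> t \<Longrightarrow> (\<lambda>s. \<Sum>n<m. X n s (s (Suc n))) \<in> borel_measurable (PiM {1..m} (\<lambda>_. M))" .
  interpret product_sigma_finite "\<lambda>_::nat. M"
    by (simp add: product_sigma_finite_def sigma_finite_measure_axioms)
  show "m \<le> t \<Longrightarrow> (\<integral>\<^sup>+s. ennreal (exp (l * (\<Sum>n<m. X n s (s (Suc n))))) \<partial>PiM {1..m} (\<lambda>_. M))
      \<le> ennreal (exp (real m * (l\<^sup>2 * b\<^sup>2 / 2)))"
  proof (induction m)
    case 0
    interpret N: prob_space "PiM {} (\<lambda>_::nat. M)"
      by (intro prob_space_PiM prob_space_axioms)
    show ?case using N.emeasure_space_1 by simp
  next
    case (Suc m)
    let ?N = "PiM {1..m} (\<lambda>_. M)" and ?S = "\<lambda>m s. \<Sum>n<m. X n s (s (Suc n))"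
    have "m < t" using Suc.prems by simp
    have ins: "{1..Suc m} = insert (Suc m) {1..m}" by auto
    have split: "?S (Suc m) (s(Suc m := x)) = ?S m s + X m s x" for s x
    proof -
      have "X n (s(Suc m := x)) ((s(Suc m := x)) (Suc n)) = X n s (s (Suc n))" if "n < m" for n
        using that past[of n "s(Suc m := x)" s] by simp
      moreover have "X m (s(Suc m := x)) x = X m s x"
        by (rule past) auto
      ultimately show ?thesis by simp
    qed
    have Sm[measurable]: "?S m \<in> borel_measurable ?N"
      using sum_meas[of m] Suc.prems by simp
    have "(\<integral>\<^sup>+s. ennreal (exp (l * ?S (Suc m) s)) \<partial>PiM {1..Suc m} (\<lambda>_. M))
        = (\<integral>\<^sup>+s. \<integral>\<^sup>+x. ennreal (exp (l * ?S (Suc m) (s(Suc m := x)))) \<partial>M \<partial>?N)"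
      unfolding ins
    proof (rule product_nn_integral_insert)
      have "?S (Suc m) \<in> borel_measurable (PiM (insert (Suc m) {1..m}) (\<lambda>_. M))"
        using sum_meas[OF Suc.prems] unfolding ins .
      then show "(\<lambda>s. ennreal (exp (l * ?S (Suc m) s)))
          \<in> borel_measurable (PiM (insert (Suc m) {1..m}) (\<lambda>_. M))"
        by measurable
    qed auto
    also have "\<dots> = (\<integral>\<^sup>+s. \<integral>\<^sup>+x. ennreal (exp (l * ?S m s)) * ennreal (exp (l * X m s x)) \<partial>M \<partial>?N)"
      by (simp only: split distrib_left exp_add ennreal_mult' exp_ge_zero)
    also have "\<dots> \<le> (\<integral>\<^sup>+s. ennreal (exp (l * ?S m s)) * ennreal (exp (l\<^sup>2 * b\<^sup>2 / 2)) \<partial>?N)"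
    proof (rule nn_integral_mono)
      fix s assume s: "s \<in> space ?N"
      have Xs[measurable]: "X m s \<in> borel_measurable M"
        using measurable_compose[OF measurable_Pair1'[OF s] meas[OF \<open>m < t\<close>]] by simp
      have "(\<integral>\<^sup>+x. ennreal (exp (l * X m s x)) \<partial>M) \<le> ennreal (exp (l\<^sup>2 * b\<^sup>2 / 2))"
        using exp_moment_centred_bounded[OF Xs bd[OF \<open>m < t\<close> s] mean[OF \<open>m < t\<close> s] l] .
      then show "(\<integral>\<^sup>+x. ennreal (exp (l * ?S m s)) * ennreal (exp (l * X m s x)) \<partial>M)
          \<le> ennreal (exp (l * ?S m s)) * ennreal (exp (l\<^sup>2 * b\<^sup>2 / 2))"
        by (subst nn_integral_cmult) (auto intro: mult_left_mono)
    qed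
    also have "\<dots> = (\<integral>\<^sup>+s. ennreal (exp (l * ?S m s)) \<partial>?N) * ennreal (exp (l\<^sup>2 * b\<^sup>2 / 2))"
      by (rule nn_integral_multc) measurable
    also have "\<dots> \<le> ennreal (exp (real m * (l\<^sup>2 * b\<^sup>2 / 2))) * ennreal (exp (l\<^sup>2 * b\<^sup>2 / 2))"
      using Suc.IH Suc.prems by (intro mult_right_mono) auto
    also have "\<dots> = ennreal (exp (real (Suc m) * (l\<^sup>2 * b\<^sup>2 / 2)))"
      by (simp add: exp_add[symmetric] ennreal_mult'[symmetric] algebra_simps)
    finally show ?case .
  qed
qed

text \<open>
  Chernoff's bound for the exponential moment, at the optimal parameter \<open>l = a / (t b\<^sup>2)\<close>.
\<close>

lemma (in prob_space) azuma_hoeffding: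
  fixes X :: "nat \<Rightarrow> (nat \<Rightarrow> 'a) \<Rightarrow> 'a \<Rightarrow> real"
  assumes meas: "\<And>n. n < t \<Longrightarrow>
      (\<lambda>(s, x). X n s x) \<in> borel_measurable (PiM {1..n} (\<lambda>_. M) \<Otimes>\<^sub>M M)"
    and past: "\<And>n s s' x. (\<And>\<tau>. \<tau> \<in> {1..n} \<Longrightarrow> s \<tau> = s' \<tau>) \<Longrightarrow> X n s x = X n s' x"
    and bd: "\<And>n s x. n < t \<Longrightarrow> s \<in> space (PiM {1..n} (\<lambda>_. M)) \<Longrightarrow> x \<in> space M \<Longrightarrow> \<bar>X n s x\<bar> \<le> b"
    and mean: "\<And>n s. n < t \<Longrightarrow> s \<in> space (PiM {1..n} (\<lambda>_. M)) \<Longrightarrow> expectation (X n s) = 0"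
    and pos: "0 < b" "0 < t" "0 < a"
  shows "measure (PiM {1..t} (\<lambda>_. M)) {s \<in> space (PiM {1..t} (\<lambda>_. M)). a \<le> (\<Sum>n<t. X n s (s (Suc n)))}
    \<le> exp (- (a\<^sup>2 / (2 * real t * b\<^sup>2)))"
proof -
  let ?Q = "PiM {1..t} (\<lambda>_. M)" and ?S = "\<lambda>s. \<Sum>n<t. X n s (s (Suc n))"
  define l where "l = a / (real t * b\<^sup>2)"
  have l: "0 < l" using pos by (simp add: l_def)
  note mom = martingale_exp_moment[OF meas past bd mean l order_refl]
  have [measurable]: "?S \<in> borel_measurable ?Q" using mom(1) by simp
  interpret Q: prob_space ?Q by (intro prob_space_PiM prob_space_axioms)
  have "emeasure ?Q {s \<in> space ?Q. a \<le> ?S s}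
      \<le> ennreal (exp (- l * a)) * (\<integral>\<^sup>+s. ennreal (exp (l * ?S s)) * indicator (space ?Q) s \<partial>?Q)"
    by (rule Chernoff_ineq_nn_integral_ge[OF l]) measurable
  also have "(\<integral>\<^sup>+s. ennreal (exp (l * ?S s)) * indicator (space ?Q) s \<partial>?Q)
      = (\<integral>\<^sup>+s. ennreal (exp (l * ?S s)) \<partial>?Q)"
    by (rule nn_integral_cong) simp
  also have "\<dots> \<le> ennreal (exp (real t * (l\<^sup>2 * b\<^sup>2 / 2)))"
    using mom(2) by simp
  also have "ennreal (exp (- l * a)) * ennreal (exp (real t * (l\<^sup>2 * b\<^sup>2 / 2)))
      = ennreal (exp (- l * a + real t * (l\<^sup>2 * b\<^sup>2 / 2)))"
    by (simp only: exp_add ennreal_mult' exp_ge_zero)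
  also have "- l * a + real t * (l\<^sup>2 * b\<^sup>2 / 2) = - (a\<^sup>2 / (2 * real t * b\<^sup>2))"
    using pos by (simp add: l_def field_simps power2_eq_square)
  finally have "emeasure ?Q {s \<in> space ?Q. a \<le> ?S s} \<le> ennreal (exp (- (a\<^sup>2 / (2 * real t * b\<^sup>2))))"
    by (simp add: mult_left_mono)
  then show ?thesis unfolding Q.emeasure_eq_measure by simp
qed

section \<open>One stage from a fixed start\<close>

context stochastic_composite_problem
begin

lemma expected_loss_convex: "convex_on UNIV (expected_loss P f)"
proof (rule convex_onI)
  fix t :: real and x y :: 'a
  assume t: "0 < t" "t < 1"
  have "expected_loss P f ((1 - t) *\<^sub>R x + t *\<^sub>R y) \<le> (\<integral>\<xi>. (1 - t) * f x \<xi> + t * f y \<xi> \<partial>P)"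
    unfolding expected_loss_def
  proof (rule integral_mono)
    fix \<xi> assume "\<xi> \<in> space P"
    then show "f ((1 - t) *\<^sub>R x + t *\<^sub>R y) \<xi> \<le> (1 - t) * f x \<xi> + t * f y \<xi>"
      using loss_convex[of \<xi>] t by (simp add: convex_on_def)
  qed (use loss_integrable in simp_all)
  also have "\<dots> = (1 - t) * expected_loss P f x + t * expected_loss P f y"
    unfolding expected_loss_def using loss_integrable by simp
  finally show "expected_loss P f ((1 - t) *\<^sub>R x + t *\<^sub>R y)
    \<le> (1 - t) * expected_loss P f x + t * expected_loss P f y" .
qed simp

lemma objective_convex: "convex_on UNIV (objective P f R)"
  unfolding objective_def[abs_def]
  using expected_loss_convex regularizer_convex by (rule convex_on_add)

lemma objective_continuous: "continuous_on UNIV (objective P f R)"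
  using objective_convex by (intro convex_on_continuous) auto

lemma mean_subgradient_measurable: "(\<lambda>w. \<integral>x. g w x \<partial>P) \<in> borel_measurable borel"
  using subgradient_measurable by (intro borel_measurable_lebesgue_integral)

text \<open>
  Jensen's inequality for the average, then the subgradient inequality of the expected loss at each
  iterate. The regularizer is kept as it stands since \<open>stage_regret\<close> accounts for it.
\<close>

lemma objective_stage_average_le:
  assumes "0 < t"
  shows "real t * (objective P f R (stage_average g R t \<eta> D w s) - objective P f R u)
    \<le> (\<Sum>n<t. (\<integral>x. g (stage_iterate g R \<eta> D w s n) x \<partial>P) \<bullet> (stage_iterate g R \<eta> D w s n - u)
        + R (stage_iterate g R \<eta> D w s n) - R u)"
proof -
  let ?F = "objective P f R" and ?y = "stage_iterate g R \<eta> D w s"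
  have "?F (\<Sum>n<t. (1 / real t) *\<^sub>R ?y n) \<le> (\<Sum>n<t. (1 / real t) * ?F (?y n))"
    using assms by (intro convex_on_sum[OF _ _ objective_convex]) auto
  then have "real t * ?F (stage_average g R t \<eta> D w s) \<le> (\<Sum>n<t. ?F (?y n))"
    using assms by (simp add: stage_average_eq scaleR_sum_right sum_divide_distrib[symmetric] field_simps)
  then have "real t * (?F (stage_average g R t \<eta> D w s) - ?F u) \<le> (\<Sum>n<t. ?F (?y n) - ?F u)"
    by (simp add: algebra_simps sum_subtractf)
  also have "\<dots> \<le> (\<Sum>n<t. (\<integral>x. g (?y n) x \<partial>P) \<bullet> (?y n - u) + R (?y n) - R u)"
  proof (rule sum_mono)
    fix n
    have "expected_loss P f u \<ge> expected_loss P f (?y n) + (\<integral>x. g (?y n) x \<partial>P) \<bullet> (u - ?y n)"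
      using expected_subgradient[of "?y n"] by (simp add: subdifferential_def)
    then show "?F (?y n) - ?F u \<le> (\<integral>x. g (?y n) x \<partial>P) \<bullet> (?y n - u) + R (?y n) - R u"
      by (simp add: objective_def inner_diff_right)
  qed
  finally show ?thesis .
qed

text \<open>
  An increment is the inner product of a centred subgradient, of norm at most \<open>2 G\<close>, with the
  difference of two points of the ball, of norm at most \<open>2 D\<close>.
\<close>

lemma subgradient_noise_tail:
  assumes G: "0 < G" "\<And>w x. x \<in> space P \<Longrightarrow> norm (g w x) \<le> G"
    and lip: "\<And>x y. R x - R y \<le> \<rho> * norm (x - y)"
    and D: "0 < D" and eta: "0 < \<eta>" and u: "u \<in> cball w D" and t: "0 < t" and a: "0 < a"
  shows "measure (PiM {1..t} (\<lambda>_. P)) {s \<in> space (PiM {1..t} (\<lambda>_. P)).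
      a \<le> (\<Sum>n<t. ((\<integral>x. g (stage_iterate g R \<eta> D w s n) x \<partial>P)
                     - g (stage_iterate g R \<eta> D w s n) (s (Suc n)))
                   \<bullet> (stage_iterate g R \<eta> D w s n - u))}
    \<le> exp (- (a\<^sup>2 / (2 * real t * (4 * G * D)\<^sup>2)))"
proof -
  define y where "y = (\<lambda>n s. stage_iterate g R \<eta> D w s n)"
  define X where "X = (\<lambda>n s x. ((\<integral>x. g (y n s) x \<partial>P) - g (y n s) x) \<bullet> (y n s - u))"
  have near: "norm (y n s - u) \<le> 2 * D" for n s
  proof -
    have "norm (y n s - w) \<le> D" "norm (w - u) \<le> D"
      using stage_iterate_in_cball[OF regularizer_convex, of D g \<eta> w s n] D u
      by (auto simp: y_def dist_norm norm_minus_commute)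
    then show ?thesis using norm_triangle_ineq[of "y n s - w" "w - u"] by simp
  qed
  have mean_le: "norm (\<integral>x. g v x \<partial>P) \<le> G" for v
  proof -
    have "norm (\<integral>x. g v x \<partial>P) \<le> (\<integral>x. norm (g v x) \<partial>P)"
      by (rule integral_norm_bound)
    also have "\<dots> \<le> (\<integral>x. G \<partial>P)"
      using subgradient_integrable G by (intro integral_mono) auto
    finally show ?thesis by (simp add: prob_space)
  qed
  have "measure (PiM {1..t} (\<lambda>_. P))
      {s \<in> space (PiM {1..t} (\<lambda>_. P)). a \<le> (\<Sum>n<t. X n s (s (Suc n)))}
    \<le> exp (- (a\<^sup>2 / (2 * real t * (4 * G * D)\<^sup>2)))"
  proof (rule azuma_hoeffding)
    fix n assume "n < t"
    have [measurable]: "y n \<in> borel_measurable (PiM {1..n} (\<lambda>_. P))"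
      unfolding y_def using D eta
      by (intro stage_iterate_measurable_fixed_start[OF regularizer_convex _ _ lip subgradient_measurable]) auto
    note [measurable] = mean_subgradient_measurable subgradient_measurable
    show "(\<lambda>(s, x). X n s x) \<in> borel_measurable (PiM {1..n} (\<lambda>_. P) \<Otimes>\<^sub>M P)"
      unfolding X_def by measurable
  next
    fix n x and s s' :: "nat \<Rightarrow> 'x"
    assume "\<And>\<tau>. \<tau> \<in> {1..n} \<Longrightarrow> s \<tau> = s' \<tau>"
    then have "y n s = y n s'" unfolding y_def by (rule stage_iterate_cong)
    then show "X n s x = X n s' x" by (simp add: X_def)
  next
    fix n s x assume "x \<in> space P"
    have "\<bar>X n s x\<bar> \<le> norm ((\<integral>x. g (y n s) x \<partial>P) - g (y n s) x) * norm (y n s - u)"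
      unfolding X_def by (rule Cauchy_Schwarz_ineq2)
    also have "\<dots> \<le> (2 * G) * (2 * D)"
    proof (rule mult_mono)
      show "norm ((\<integral>x. g (y n s) x \<partial>P) - g (y n s) x) \<le> 2 * G"
        using norm_triangle_ineq4[of "\<integral>x. g (y n s) x \<partial>P" "g (y n s) x"]
          mean_le[of "y n s"] G(2)[OF \<open>x \<in> space P\<close>, of "y n s"] by linarith
    qed (use near G in auto)
    finally show "\<bar>X n s x\<bar> \<le> 4 * G * D" by simp
  next
    fix n s
    show "expectation (X n s) = 0"
      unfolding X_def using subgradient_integrable by (simp add: prob_space)
  qed (use G D t a in auto)
  then show ?thesis unfolding X_def y_def .
qed

text \<open>
  With this step size the terms \<open>D\<^sup>2 / (2 \<eta> t)\<close>, \<open>\<eta> G\<^sup>2 / 2\<close> and \<open>\<rho> D / t\<close> are each at most \<open>e / 8\<close>. A gap above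
  \<open>e / 2\<close> thus forces the noise to reach \<open>t e / 8\<close>, which has probability at most
  \<open>exp (- t e\<^sup>2 / (2048 G\<^sup>2 D\<^sup>2))\<close>.
\<close>

lemma stage_high_probability:
  assumes G: "0 < G" "\<And>w x. x \<in> space P \<Longrightarrow> norm (g w x) \<le> G"
    and rho: "0 \<le> \<rho>" and lip: "\<And>x y. R x - R y \<le> \<rho> * norm (x - y)"
    and D: "0 < D" and e: "0 < e" and u: "u \<in> cball w D" and \<delta>: "0 < \<delta>" "\<delta> \<le> 1"
    and t: "16 * (G\<^sup>2 * D\<^sup>2 / e\<^sup>2) \<le> real t" "3072 * ln (1 / \<delta>) * (G\<^sup>2 * D\<^sup>2 / e\<^sup>2) \<le> real t"
      "8 * \<rho> * D / e \<le> real t"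
  shows "measure (PiM {1..t} (\<lambda>_. P)) {s \<in> space (PiM {1..t} (\<lambda>_. P)).
      e / 2 < objective P f R (stage_average g R t (e / (4 * G\<^sup>2)) D w s) - objective P f R u} \<le> \<delta>"
proof -
  let ?F = "objective P f R" and ?Q = "PiM {1..t} (\<lambda>_. P)"
  define \<eta> where "\<eta> = e / (4 * G\<^sup>2)"
  have eta: "0 < \<eta>" using G e by (simp add: \<eta>_def)
  have "0 < 16 * (G\<^sup>2 * D\<^sup>2 / e\<^sup>2)" using G D e by simp
  then have "0 < real t" using t(1) by linarith
  then have t0: "0 < t" by simp
  let ?y = "\<lambda>s. stage_iterate g R \<eta> D w s"
  let ?noise = "\<lambda>s. \<Sum>n<t. ((\<integral>x. g (?y s n) x \<partial>P) - g (?y s n) (s (Suc n))) \<bullet> (?y s n - u)"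
  define a where "a = real t * e / 8"
  have a: "0 < a" using t0 e by (simp add: a_def)
  interpret Q: prob_space ?Q by (intro prob_space_PiM prob_space_axioms)
  have sub: "a \<le> ?noise s" if s: "s \<in> space ?Q" and bad: "e / 2 < ?F (stage_average g R t \<eta> D w s) - ?F u" for s
  proof -
    have "norm (g v (s \<tau>)) \<le> G" if "\<tau> \<in> {1..t}" for v \<tau>
      using s that by (intro G(2)) (auto simp: space_PiM)
    note regret = stage_regret[OF regularizer_convex less_imp_le[OF D] eta lip rho u, of t g s G, OF this]
    have "real t * (e / 2) < real t * (?F (stage_average g R t \<eta> D w s) - ?F u)"
      using bad t0 by simp
    also have "\<dots> \<le> (\<Sum>n<t. (\<integral>x. g (?y s n) x \<partial>P) \<bullet> (?y s n - u) + R (?y s n) - R u)"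
      by (rule objective_stage_average_le[OF t0])
    also have "\<dots> = ?noise s + (\<Sum>n<t. g (?y s n) (s (Suc n)) \<bullet> (?y s n - u) + R (?y s n) - R u)"
      by (simp add: sum.distrib[symmetric] inner_diff_left add_diff_eq)
    also have "\<dots> \<le> ?noise s + (D\<^sup>2 / (2 * \<eta>) + real t * (\<eta> * G\<^sup>2 / 2) + \<rho> * D)"
      using regret by simp
    also have "D\<^sup>2 / (2 * \<eta>) \<le> real t * e / 8"
      using t(1) G e by (simp add: \<eta>_def field_simps power2_eq_square)
    also have "\<eta> * G\<^sup>2 / 2 = e / 8"
      using G by (simp add: \<eta>_def field_simps)
    also have "\<rho> * D \<le> real t * e / 8"
      using t(3) e by (simp add: field_simps)
    finally show ?thesis by (simp add: a_def algebra_simps)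
  qed
  have "measure ?Q {s \<in> space ?Q. e / 2 < ?F (stage_average g R t \<eta> D w s) - ?F u}
      \<le> measure ?Q {s \<in> space ?Q. a \<le> ?noise s}"
  proof (rule Q.finite_measure_mono)
    show "{s \<in> space ?Q. e / 2 < ?F (stage_average g R t \<eta> D w s) - ?F u} \<subseteq> {s \<in> space ?Q. a \<le> ?noise s}"
      using sub by blast
    have "(\<lambda>s. ((\<integral>x. g (?y s n) x \<partial>P) - g (?y s n) (s (Suc n))) \<bullet> (?y s n - u)) \<in> borel_measurable ?Q"
      if "n < t" for n
    proof -
      have [measurable]: "(\<lambda>s. ?y s n) \<in> borel_measurable ?Q"
        using D eta that
        by (intro stage_iterate_measurable_fixed_start[OF regularizer_convex _ _ lip subgradient_measurable]) auto
      have [measurable]: "Suc n \<in> {1..t}" using that by simp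
      note [measurable] = mean_subgradient_measurable subgradient_measurable
      show ?thesis by measurable
    qed
    then have [measurable]: "?noise \<in> borel_measurable ?Q"
      by (intro borel_measurable_sum) auto
    show "{s \<in> space ?Q. a \<le> ?noise s} \<in> Q.events" by measurable
  qed
  also have "\<dots> \<le> exp (- (a\<^sup>2 / (2 * real t * (4 * G * D)\<^sup>2)))"
    by (rule subgradient_noise_tail[OF G lip D eta u t0 a])
  also have "\<dots> \<le> exp (- ln (1 / \<delta>))"
  proof -
    have "0 \<le> ln (1 / \<delta>)" using \<delta> by simp
    then have "2048 * ln (1 / \<delta>) * (G\<^sup>2 * D\<^sup>2 / e\<^sup>2) \<le> 3072 * ln (1 / \<delta>) * (G\<^sup>2 * D\<^sup>2 / e\<^sup>2)"
      by (intro mult_right_mono) auto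
    then have "2048 * ln (1 / \<delta>) * (G\<^sup>2 * D\<^sup>2 / e\<^sup>2) \<le> real t" using t(2) by linarith
    then have "ln (1 / \<delta>) \<le> a\<^sup>2 / (2 * real t * (4 * G * D)\<^sup>2)"
      using G D e t0 by (simp add: a_def field_simps power2_eq_square)
    then show ?thesis by simp
  qed
  also have "\<dots> = \<delta>" using \<delta> by (simp add: ln_div)
  finally show ?thesis unfolding \<eta>_def .
qed

end

section \<open>The local error bound\<close>

lemma minimizers_iff_min_value:
  assumes "minimizers h \<noteq> {}"
  shows "minimizers h = {w. h w \<le> min_value h}" and "min_value h \<le> h w"
proof -
  obtain m where "\<And>w. h m \<le> h w"
    using assms by (auto simp: minimizers_def is_arg_min_linorder)
  then have m: "min_value h = h m"
    unfolding min_value_def by (intro cInf_eq_minimum) auto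
  show "min_value h \<le> h w" unfolding m by fact
  show "minimizers h = {w. h w \<le> min_value h}"
    unfolding m minimizers_def is_arg_min_linorder
    using \<open>\<And>w. h m \<le> h w\<close> order_trans by auto
qed

text \<open>
  The point \<open>u\<close> lies on the segment from \<open>w\<close> to its nearest minimizer \<open>m\<close>, at the fraction where convexity
  guarantees a gap of at most \<open>\<epsilon>\<close>. No minimizer is closer to \<open>u\<close> than \<open>m\<close>, since it would also
  be closer to \<open>w\<close>; so the error bound at \<open>u\<close> limits the distance from \<open>u\<close> to \<open>m\<close>, and proportionality
  along the segment limits the distance from \<open>w\<close> to \<open>u\<close>.
\<close>

lemma error_bound_distance_to_sublevel:
  fixes h :: "'a::euclidean_space \<Rightarrow> real"
  assumes h: "convex_on UNIV h" and min: "minimizers h \<noteq> {}"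
    and eb: "local_error_bound h \<epsilon> c \<theta>"
    and pos: "0 < \<epsilon>" "0 < \<theta>" "0 < c" "0 \<le> e"
    and w: "h w - min_value h \<le> \<epsilon> + e"
  obtains u where "h u - min_value h \<le> \<epsilon>" and "norm (w - u) \<le> c * e / \<epsilon> powr (1 - \<theta>)"
proof (cases "h w - min_value h \<le> \<epsilon>")
  case True
  then show ?thesis using pos by (intro that[of w]) auto
next
  case False
  define \<Delta> where "\<Delta> = h w - min_value h"
  define s where "s = \<epsilon> / \<Delta>"
  define m where "m = closest_point (minimizers h) w"
  define u where "u = (1 - s) *\<^sub>R m + s *\<^sub>R w"
  define m' where "m' = closest_point (minimizers h) u"
  have \<Delta>: "\<epsilon> < \<Delta>" "\<Delta> \<le> \<epsilon> + e" using False w by (auto simp: \<Delta>_def)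
  have s: "0 < s" "s < 1" using \<Delta> pos by (auto simp: s_def)
  have "continuous_on UNIV h" using h by (intro convex_on_continuous) auto
  then have closed: "closed (minimizers h)"
    unfolding minimizers_iff_min_value(1)[OF min] by (intro closed_Collect_le) auto
  have m: "m \<in> minimizers h" and m': "m' \<in> minimizers h"
    unfolding m_def m'_def by (rule closest_point_in_set[OF closed min])+
  have "h u \<le> (1 - s) * h m + s * h w"
    using h s by (simp add: u_def convex_on_def)
  also have "\<dots> \<le> (1 - s) * min_value h + s * h w"
    using m s by (simp add: minimizers_iff_min_value(1)[OF min])
  also have "\<dots> = min_value h + s * \<Delta>"
    by (simp add: \<Delta>_def algebra_simps)
  also have "s * \<Delta> = \<epsilon>" using \<Delta> pos by (simp add: s_def)
  finally have hu: "h u - min_value h \<le> \<epsilon>" by simp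
  have wu: "norm (w - u) = (1 - s) * norm (w - m)"
  proof -
    have "w - u = (1 - s) *\<^sub>R (w - m)" by (simp add: u_def algebra_simps)
    then show ?thesis using s by simp
  qed
  have "norm (u - m') \<le> c * (h u - min_value h) powr \<theta>"
    using eb hu by (simp add: local_error_bound_def eps_sublevel_def m'_def)
  also have "\<dots> \<le> c * \<epsilon> powr \<theta>"
    using hu pos minimizers_iff_min_value(2)[OF min, of u]
    by (intro mult_left_mono powr_mono2) auto
  finally have um': "norm (u - m') \<le> c * \<epsilon> powr \<theta>" .
  have "norm (w - m) \<le> norm (w - m')"
    using closest_point_le[OF closed m', of w] by (simp add: m_def dist_norm)
  also have "\<dots> \<le> norm (w - u) + norm (u - m')"
    using norm_triangle_ineq[of "w - u" "u - m'"] by simp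
  finally have "s * norm (w - m) \<le> c * \<epsilon> powr \<theta>"
    using um' wu by (simp add: algebra_simps)
  then have "\<epsilon> * norm (w - m) \<le> \<Delta> * (c * \<epsilon> powr \<theta>)"
    using \<Delta> pos by (simp add: s_def field_simps)
  moreover have "norm (w - u) * \<Delta> = (\<Delta> - \<epsilon>) * norm (w - m)"
    using \<Delta> pos by (simp add: wu s_def field_simps)
  ultimately have "\<epsilon> * norm (w - u) * \<Delta> \<le> (\<Delta> - \<epsilon>) * (\<Delta> * (c * \<epsilon> powr \<theta>))"
    using \<Delta> by (smt (verit) mult.assoc mult.left_commute mult_left_mono)
  then have "\<epsilon> * norm (w - u) \<le> (\<Delta> - \<epsilon>) * (c * \<epsilon> powr \<theta>)"
    using \<Delta> pos by (simp add: mult.left_commute mult.commute)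
  also have "\<dots> \<le> e * (c * \<epsilon> powr \<theta>)"
    using \<Delta> pos by (intro mult_right_mono) auto
  finally have "norm (w - u) \<le> e * (c * \<epsilon> powr \<theta>) / \<epsilon>"
    using pos by (simp add: field_simps)
  also have "\<dots> = c * e / \<epsilon> powr (1 - \<theta>)"
    using pos by (simp add: powr_diff field_simps)
  finally show ?thesis using hu that by blast
qed

section \<open>Independence of the stages\<close>

text \<open>
  Freezing an independent past: a bound that holds for each fixed value of \<open>H\<close> holds for the random
  value. The map \<open>b\<close> changes the index set of the present samples; past and present are families with
  the same index type, as \<open>indep_var\<close> requires both variables to take values in one type.
\<close>

lemma (in prob_space) prob_le_of_conditional_prob_le:
  assumes indep: "indep_var N H Q B" and b: "b \<in> measurable Q Q'"
    and law: "distr M Q' (\<lambda>\<omega>. b (B \<omega>)) = L" and A: "A \<in> sets (N \<Otimes>\<^sub>M Q')"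
    and cond: "\<And>h. h \<in> space N \<Longrightarrow> measure L {y \<in> space L. (h, y) \<in> A} \<le> \<delta>"
  shows "prob {\<omega> \<in> space M. (H \<omega>, b (B \<omega>)) \<in> A} \<le> \<delta>"
proof -
  have H[measurable]: "H \<in> measurable M N" and B[measurable]: "B \<in> measurable M Q"
    using indep by (auto dest: indep_var_rv1 indep_var_rv2)
  note [measurable] = b
  let ?B = "distr M Q B"
  have joint: "distr M N H \<Otimes>\<^sub>M ?B = distr M (N \<Otimes>\<^sub>M Q) (\<lambda>\<omega>. (H \<omega>, B \<omega>))"
    using indep by (simp add: indep_var_distribution_eq)
  interpret N: prob_space "distr M N H" by (rule prob_space_distr[OF H])
  interpret Q: prob_space ?B by (rule prob_space_distr[OF B])
  have L: "distr ?B Q' b = L" unfolding law[symmetric] by (simp add: distr_distr comp_def)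
  interpret L: prob_space L unfolding L[symmetric] by (rule Q.prob_space_distr) simp
  have sp: "sets L = sets Q'" "space L = space Q'" unfolding L[symmetric] by simp_all
  obtain h where "h \<in> space N" using N.not_empty by auto
  then have "0 \<le> \<delta>" using cond measure_nonneg order_trans by metis
  define A' where "A' = {z \<in> space (N \<Otimes>\<^sub>M Q). (fst z, b (snd z)) \<in> A}"
  have A': "A' \<in> sets (N \<Otimes>\<^sub>M Q)"
    unfolding A'_def using A by measurable
  have "emeasure M {\<omega> \<in> space M. (H \<omega>, b (B \<omega>)) \<in> A} = emeasure (distr M N H \<Otimes>\<^sub>M ?B) A'"
    unfolding joint using A' measurable_space[OF H] measurable_space[OF B]
    by (subst emeasure_distr) (auto simp: A'_def space_pair_measure intro!: arg_cong2[where f=emeasure])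
  also have "\<dots> = (\<integral>\<^sup>+h. emeasure ?B (Pair h -` A') \<partial>distr M N H)"
    using A' by (intro Q.emeasure_pair_measure_alt) (simp cong: sets_pair_measure_cong)
  also have "\<dots> \<le> (\<integral>\<^sup>+h. ennreal \<delta> \<partial>distr M N H)"
  proof (rule nn_integral_mono)
    fix h assume "h \<in> space (distr M N H)"
    then have h: "h \<in> space N" by simp
    let ?Y = "{y \<in> space L. (h, y) \<in> A}"
    have "?Y = Pair h -` A"
      using sets.sets_into_space[OF A] sp by (auto simp: space_pair_measure)
    then have Y: "?Y \<in> sets Q'" using sets_Pair1[OF A] by simp
    have "Pair h -` A' = b -` ?Y \<inter> space ?B"
      using h measurable_space[OF b] sp by (auto simp: A'_def space_pair_measure)
    then have "emeasure ?B (Pair h -` A') = emeasure (distr ?B Q' b) ?Y"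
      using Y by (subst emeasure_distr) auto
    then show "emeasure ?B (Pair h -` A') \<le> ennreal \<delta>"
      using cond[OF h] by (simp add: L L.emeasure_eq_measure ennreal_leI)
  qed
  also have "\<dots> = ennreal \<delta>" by (simp only: nn_integral_const N.emeasure_space_1 mult_1_right)
  finally show ?thesis using \<open>0 \<le> \<delta>\<close> by (simp add: emeasure_eq_measure)
qed

lemma proxASSG_state_eq:
  "proxASSG_state g R t \<eta>\<^sub>1 D\<^sub>1 w\<^sub>0 s k
     = (fst (proxASSG_state g R t \<eta>\<^sub>1 D\<^sub>1 w\<^sub>0 s k), \<eta>\<^sub>1 / 2 ^ k, D\<^sub>1 / 2 ^ k)"
  by (induction k) (auto simp: split: prod.splits)

lemma proxASSG_state_Suc:
  "fst (proxASSG_state g R t \<eta>\<^sub>1 D\<^sub>1 w\<^sub>0 s (Suc k))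
     = stage_average g R t (\<eta>\<^sub>1 / 2 ^ k) (D\<^sub>1 / 2 ^ k) (fst (proxASSG_state g R t \<eta>\<^sub>1 D\<^sub>1 w\<^sub>0 s k)) (s (Suc k))"
  by (simp, subst proxASSG_state_eq) simp

lemma proxASSG_state_cong:
  assumes "\<And>i \<tau>. i \<in> {1..k} \<Longrightarrow> \<tau> \<in> {1..t} \<Longrightarrow> s i \<tau> = s' i \<tau>"
  shows "fst (proxASSG_state g R t \<eta>\<^sub>1 D\<^sub>1 w\<^sub>0 s k) = fst (proxASSG_state g R t \<eta>\<^sub>1 D\<^sub>1 w\<^sub>0 s' k)"
  using assms
proof (induction k)
  case (Suc k)
  have "fst (proxASSG_state g R t \<eta>\<^sub>1 D\<^sub>1 w\<^sub>0 s k) = fst (proxASSG_state g R t \<eta>\<^sub>1 D\<^sub>1 w\<^sub>0 s' k)"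
    using Suc.prems by (intro Suc.IH) auto
  then show ?case
    unfolding proxASSG_state_Suc
    by (metis (no_types, lifting) stage_average_cong Suc.prems atLeastAtMost_iff le_add1 order_refl plus_1_eq_Suc)
qed simp

lemma proxASSG_state_measurable:
  fixes R :: "'a::euclidean_space \<Rightarrow> real"
  assumes R: "convex_on UNIV R" and D: "0 \<le> D\<^sub>1" and eta: "0 \<le> \<eta>\<^sub>1"
    and lip: "\<And>x y. R x - R y \<le> \<rho> * norm (x - y)"
    and g: "(\<lambda>(w, x). g w x) \<in> borel_measurable (borel \<Otimes>\<^sub>M P)"
  shows "{1..k} \<times> {1..t} \<subseteq> J \<Longrightarrow>
    (\<lambda>x. fst (proxASSG_state g R t \<eta>\<^sub>1 D\<^sub>1 w\<^sub>0 (\<lambda>i \<tau>. x (i, \<tau>)) k)) \<in> borel_measurable (PiM J (\<lambda>_. P))"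
proof (induction k)
  case (Suc k)
  let ?w = "\<lambda>x. fst (proxASSG_state g R t \<eta>\<^sub>1 D\<^sub>1 w\<^sub>0 (\<lambda>i \<tau>. x (i, \<tau>)) k)"
  have [measurable]: "?w \<in> borel_measurable (PiM J (\<lambda>_. P))"
    using Suc.prems by (intro Suc.IH) auto
  have [measurable]: "(\<lambda>x. \<lambda>\<tau>\<in>{1..t}. x (Suc k, \<tau>)) \<in> measurable (PiM J (\<lambda>_. P)) (PiM {1..t} (\<lambda>_. P))"
    using Suc.prems by (intro measurable_restrict measurable_component_singleton) auto
  have [measurable]: "(\<lambda>(w, s). stage_average g R t (\<eta>\<^sub>1 / 2 ^ k) (D\<^sub>1 / 2 ^ k) w s)
      \<in> borel_measurable (borel \<Otimes>\<^sub>M PiM {1..t} (\<lambda>_. P))"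
    using D eta by (intro stage_average_measurable[OF R _ _ lip g]) auto
  have "(\<lambda>x. (\<lambda>(w, s). stage_average g R t (\<eta>\<^sub>1 / 2 ^ k) (D\<^sub>1 / 2 ^ k) w s)
      (?w x, \<lambda>\<tau>\<in>{1..t}. x (Suc k, \<tau>))) \<in> borel_measurable (PiM J (\<lambda>_. P))"
    by measurable
  moreover have "stage_average g R t \<eta> D w (\<lambda>\<tau>\<in>{1..t}. x (Suc k, \<tau>))
      = stage_average g R t \<eta> D w (\<lambda>\<tau>. x (Suc k, \<tau>))" for \<eta> D w x
    by (rule stage_average_cong) simp
  ultimately show ?case unfolding proxASSG_state_Suc by simp
qed simp

lemma (in prob_space) distr_sample_row:
  assumes P: "prob_space P"
    and indep: "indep_vars (\<lambda>_. P) (\<lambda>(k, \<tau>). \<xi> k \<tau>) I" and row: "Pair k ` J \<subseteq> I" and "J \<noteq> {}"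
    and law: "\<And>\<tau>. \<tau> \<in> J \<Longrightarrow> distr M P (\<xi> k \<tau>) = P"
  shows "distr M (PiM J (\<lambda>_. P)) (\<lambda>\<omega>. \<lambda>\<tau>\<in>J. \<xi> k \<tau> \<omega>) = PiM J (\<lambda>_. P)"
proof -
  let ?B = "Pair k ` J" and ?X = "\<lambda>(k, \<tau>). \<xi> k \<tau>"
  have ind: "indep_vars (\<lambda>_. P) ?X ?B" using indep_vars_subset[OF indep row] .
  have rv: "random_variable P (?X p)" if "p \<in> ?B" for p
    using ind that by (auto simp: indep_vars_def)
  have "distr M (PiM ?B (\<lambda>_. P)) (\<lambda>\<omega>. \<lambda>p\<in>?B. ?X p \<omega>) = PiM ?B (\<lambda>p. distr M P (?X p))"
    using ind by (subst (asm) indep_vars_iff_distr_eq_PiM') (use rv \<open>J \<noteq> {}\<close> in auto)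
  also have "\<dots> = PiM ?B (\<lambda>_. P)"
    using law by (intro PiM_cong) auto
  finally have joint: "distr M (PiM ?B (\<lambda>_. P)) (\<lambda>\<omega>. \<lambda>p\<in>?B. ?X p \<omega>) = PiM ?B (\<lambda>_. P)" .
  have [measurable]: "(\<lambda>\<omega>. \<lambda>p\<in>?B. ?X p \<omega>) \<in> measurable M (PiM ?B (\<lambda>_. P))"
    by (intro measurable_restrict rv)
  have [measurable]: "(\<lambda>x. \<lambda>\<tau>\<in>J. x (k, \<tau>)) \<in> measurable (PiM ?B (\<lambda>_. P)) (PiM J (\<lambda>_. P))"
    by (intro measurable_restrict measurable_component_singleton) auto
  have "PiM J (\<lambda>_. P) = distr (PiM ?B (\<lambda>_. P)) (PiM J (\<lambda>_. P)) (\<lambda>x. \<lambda>\<tau>\<in>J. x (k, \<tau>))"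
    by (rule distr_PiM_reindex[symmetric]) (auto simp: P inj_on_def)
  also have "\<dots> = distr M (PiM J (\<lambda>_. P)) ((\<lambda>x. \<lambda>\<tau>\<in>J. x (k, \<tau>)) \<circ> (\<lambda>\<omega>. \<lambda>p\<in>?B. ?X p \<omega>))"
    by (subst joint[symmetric], rule distr_distr) measurable
  also have "(\<lambda>x. \<lambda>\<tau>\<in>J. x (k, \<tau>)) \<circ> (\<lambda>\<omega>. \<lambda>p\<in>?B. ?X p \<omega>) = (\<lambda>\<omega>. \<lambda>\<tau>\<in>J. \<xi> k \<tau> \<omega>)"
    by (auto simp: fun_eq_iff restrict_def)
  finally show ?thesis by (rule sym)
qed

section \<open>All stages\<close>

context stochastic_composite_problem
begin

text \<open>
  The comparison point from the error bound lies in the ball of the stage and has gap at most \<open>\<epsilon>\<close>, so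
  reaching it up to \<open>e / 2\<close> halves the excess over \<open>\<epsilon>\<close>.
\<close>

lemma stage_failure_probability:
  assumes G: "0 < G" "\<And>w x. x \<in> space P \<Longrightarrow> norm (g w x) \<le> G"
    and rho: "0 \<le> \<rho>" and lip: "\<And>x y. R x - R y \<le> \<rho> * norm (x - y)"
    and eb: "local_error_bound (objective P f R) \<epsilon> c \<theta>" and pos: "0 < \<epsilon>" "0 < \<theta>" "0 < c"
    and D: "0 < D" "c * e / \<epsilon> powr (1 - \<theta>) \<le> D" and e: "0 < e" and \<delta>: "0 < \<delta>" "\<delta> \<le> 1"
    and t: "16 * (G\<^sup>2 * D\<^sup>2 / e\<^sup>2) \<le> real t" "3072 * ln (1 / \<delta>) * (G\<^sup>2 * D\<^sup>2 / e\<^sup>2) \<le> real t"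
      "8 * \<rho> * D / e \<le> real t"
    and w: "objective P f R w - min_value (objective P f R) \<le> \<epsilon> + e"
  shows "measure (PiM {1..t} (\<lambda>_. P)) {s \<in> space (PiM {1..t} (\<lambda>_. P)).
      \<epsilon> + e / 2 < objective P f R (stage_average g R t (e / (4 * G\<^sup>2)) D w s)
                    - min_value (objective P f R)} \<le> \<delta>"
proof -
  let ?F = "objective P f R" and ?Q = "PiM {1..t} (\<lambda>_. P)"
  let ?avg = "\<lambda>s. stage_average g R t (e / (4 * G\<^sup>2)) D w s"
  obtain u where u: "?F u - min_value ?F \<le> \<epsilon>" and "norm (w - u) \<le> c * e / \<epsilon> powr (1 - \<theta>)"
    using error_bound_distance_to_sublevel[OF objective_convex minimum_attained eb pos less_imp_le[OF e] w] .
  then have "u \<in> cball w D" using D by (simp add: dist_norm)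
  note high = stage_high_probability[OF G rho lip D(1) e this \<delta> t]
  interpret Q: prob_space ?Q by (intro prob_space_PiM prob_space_axioms)
  have [measurable]: "?avg \<in> borel_measurable ?Q"
    using D e
    by (intro stage_average_measurable_fixed_start[OF regularizer_convex _ _ lip subgradient_measurable]) auto
  have [measurable]: "?F \<in> borel_measurable borel"
    by (intro borel_measurable_continuous_onI objective_continuous)
  have "measure ?Q {s \<in> space ?Q. \<epsilon> + e / 2 < ?F (?avg s) - min_value ?F}
      \<le> measure ?Q {s \<in> space ?Q. e / 2 < ?F (?avg s) - ?F u}"
  proof (rule Q.finite_measure_mono)
    show "{s \<in> space ?Q. \<epsilon> + e / 2 < ?F (?avg s) - min_value ?F}
        \<subseteq> {s \<in> space ?Q. e / 2 < ?F (?avg s) - ?F u}"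
      using u by auto
    show "{s \<in> space ?Q. e / 2 < ?F (?avg s) - ?F u} \<in> Q.events" by measurable
  qed
  then show ?thesis using high by simp
qed

text \<open>
  Stage \<open>k + 1\<close> can break the invariant only if it was broken before or if the stage fails from a start
  that satisfies it. Conditionally on the start, the latter has probability at most \<open>\<delta>\<close>, so each stage adds
  \<open>\<delta>\<close>.
\<close>

lemma proxASSG_stages_failure_probability:
  assumes G: "0 < G" "\<And>w x. x \<in> space P \<Longrightarrow> norm (g w x) \<le> G"
    and rho: "0 \<le> \<rho>" and lip: "\<And>x y. R x - R y \<le> \<rho> * norm (x - y)"
    and eb: "local_error_bound (objective P f R) \<epsilon> c \<theta>" and pos: "0 < \<epsilon>" "0 < \<theta>" "0 < c"
    and D: "c * \<epsilon>\<^sub>0 / \<epsilon> powr (1 - \<theta>) \<le> D\<^sub>1" and e: "0 < \<epsilon>\<^sub>0" and \<delta>: "0 < \<delta>" "\<delta> \<le> 1"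
    and t: "16 * (G\<^sup>2 * D\<^sub>1\<^sup>2 / \<epsilon>\<^sub>0\<^sup>2) \<le> real t" "3072 * ln (1 / \<delta>) * (G\<^sup>2 * D\<^sub>1\<^sup>2 / \<epsilon>\<^sub>0\<^sup>2) \<le> real t"
      "8 * \<rho> * D\<^sub>1 / \<epsilon>\<^sub>0 \<le> real t"
    and start: "objective P f R w\<^sub>0 - min_value (objective P f R) \<le> \<epsilon>\<^sub>0"
    and iid: "iid_samples M P K t \<xi>"
  defines "w \<equiv> \<lambda>k \<omega>. fst (proxASSG_state g R t (\<epsilon>\<^sub>0 / (4 * G\<^sup>2)) D\<^sub>1 w\<^sub>0 (\<lambda>k \<tau>. \<xi> k \<tau> \<omega>) k)"
  shows "k \<le> K \<Longrightarrow> w k \<in> borel_measurable M"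
    and "k \<le> K \<Longrightarrow> measure M {\<omega> \<in> space M.
      \<epsilon> + \<epsilon>\<^sub>0 / 2 ^ k < objective P f R (w k \<omega>) - min_value (objective P f R)} \<le> real k * \<delta>"
proof -
  let ?F = "objective P f R" and ?Q = "PiM {1..t} (\<lambda>_. P)"
  let ?gap = "\<lambda>w. ?F w - min_value ?F"
  let ?I = "{1..K} \<times> {1..t}" and ?X = "\<lambda>(k, \<tau>). \<xi> k \<tau>"
  define \<eta>\<^sub>1 where "\<eta>\<^sub>1 = \<epsilon>\<^sub>0 / (4 * G\<^sup>2)"
  have M: "prob_space M" and indep: "prob_space.indep_vars M (\<lambda>_. P) ?X ?I"
    and law: "\<And>k \<tau>. k \<in> {1..K} \<Longrightarrow> \<tau> \<in> {1..t} \<Longrightarrow> distr M P (\<xi> k \<tau>) = P"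
    using iid by (auto simp: iid_samples_def)
  interpret M: prob_space M by (rule M)
  have "0 < c * \<epsilon>\<^sub>0 / \<epsilon> powr (1 - \<theta>)" using pos e by simp
  then have D1: "0 < D\<^sub>1" using D by linarith
  have eta1: "0 < \<eta>\<^sub>1" using e G by (simp add: \<eta>\<^sub>1_def)
  have "0 < 16 * (G\<^sup>2 * D\<^sub>1\<^sup>2 / \<epsilon>\<^sub>0\<^sup>2)" using G D1 e by simp
  then have "0 < real t" using t(1) by linarith
  then have t0: "{1..t} \<noteq> {}" by simp
  have [measurable]: "?F \<in> borel_measurable borel"
    by (intro borel_measurable_continuous_onI objective_continuous)
  let ?W = "\<lambda>k x. fst (proxASSG_state g R t \<eta>\<^sub>1 D\<^sub>1 w\<^sub>0 (\<lambda>i \<tau>. x (i, \<tau>)) k)"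
  have W_meas: "?W k \<in> borel_measurable (PiM ({1..k} \<times> {1..t}) (\<lambda>_. P))" for k
    using D1 eta1
    by (intro proxASSG_state_measurable[OF regularizer_convex _ _ lip subgradient_measurable]) auto
  have w_eq: "?W k \<circ> (\<lambda>\<omega>. \<lambda>p\<in>{1..k} \<times> {1..t}. ?X p \<omega>) = w k" for k
    unfolding w_def \<eta>\<^sub>1_def comp_def by (intro ext proxASSG_state_cong) simp
  have rv: "(\<lambda>\<omega>. \<lambda>p\<in>{1..k} \<times> {1..t}. ?X p \<omega>) \<in> measurable M (PiM ({1..k} \<times> {1..t}) (\<lambda>_. P))"
    if "k \<le> K" for k
    using indep that by (intro measurable_restrict) (auto simp: M.indep_vars_def)
  have w_meas: "w k \<in> borel_measurable M" if "k \<le> K" for k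
    unfolding w_eq[symmetric] using rv[OF that] W_meas by (rule measurable_comp)
  then show "k \<le> K \<Longrightarrow> w k \<in> borel_measurable M" .
  show "k \<le> K \<Longrightarrow> measure M {\<omega> \<in> space M. \<epsilon> + \<epsilon>\<^sub>0 / 2 ^ k < ?gap (w k \<omega>)} \<le> real k * \<delta>"
  proof (induction k)
    case 0
    have "{\<omega> \<in> space M. \<epsilon> + \<epsilon>\<^sub>0 / 2 ^ 0 < ?gap (w 0 \<omega>)} = {}"
      using start pos by (auto simp: w_def)
    then show ?case by (simp only: measure_empty)
  next
    case (Suc k)
    then have k: "k \<le> K" "Suc k \<in> {1..K}" by auto
    define e where "e = \<epsilon>\<^sub>0 / 2 ^ k"
    define D where "D = D\<^sub>1 / 2 ^ k"
    define \<eta> where "\<eta> = \<eta>\<^sub>1 / 2 ^ k"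
    \<comment> \<open>Halving accuracy and radius together leaves the requirements on t unchanged.\<close>
    have scaled: "0 < e" "0 < D" "G\<^sup>2 * D\<^sup>2 / e\<^sup>2 = G\<^sup>2 * D\<^sub>1\<^sup>2 / \<epsilon>\<^sub>0\<^sup>2"
      "8 * \<rho> * D / e = 8 * \<rho> * D\<^sub>1 / \<epsilon>\<^sub>0" "\<eta> = e / (4 * G\<^sup>2)" "0 < \<eta>"
      using \<open>0 < \<epsilon>\<^sub>0\<close> \<open>0 < G\<close> D1 eta1 by (simp_all add: e_def D_def \<eta>_def \<eta>\<^sub>1_def power_divide)
    have De: "c * e / \<epsilon> powr (1 - \<theta>) \<le> D"
      using divide_right_mono[OF \<open>c * \<epsilon>\<^sub>0 / \<epsilon> powr (1 - \<theta>) \<le> D\<^sub>1\<close>, of "2 ^ k"] by (simp add: e_def D_def mult.commute)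
    let ?avg = "\<lambda>w s. stage_average g R t \<eta> D w s"
    let ?row = "\<lambda>\<omega>. \<lambda>\<tau>\<in>{1..t}. \<xi> (Suc k) \<tau> \<omega>"
    let ?past = "{1..k} \<times> {1..t}" and ?now = "{Suc k} \<times> {1..t}"
    let ?N = "PiM ?past (\<lambda>_. P)" and ?H = "\<lambda>\<omega>. \<lambda>p\<in>?past. ?X p \<omega>"
    have W_H: "?W k (?H \<omega>) = w k \<omega>" for \<omega>
      using fun_cong[OF w_eq[of k], of \<omega>] by (simp add: comp_def)
    \<comment> \<open>The event that the stage fails although it started well, in terms of the past samples and
      the samples of the current stage.\<close>
    define A where "A = {z \<in> space (?N \<Otimes>\<^sub>M ?Q).
      ?gap (?W k (fst z)) \<le> \<epsilon> + e \<and> \<epsilon> + e / 2 < ?gap (?avg (?W k (fst z)) (snd z))}"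
    have [measurable]: "(\<lambda>(w, s). ?avg w s) \<in> borel_measurable (borel \<Otimes>\<^sub>M ?Q)"
      using stage_average_measurable[OF regularizer_convex _ _ lip subgradient_measurable, of D \<eta> t] scaled
      by simp
    note [measurable] = W_meas[of k]
    have [measurable]: "(\<lambda>z. ?avg (?W k (fst z)) (snd z)) \<in> borel_measurable (?N \<Otimes>\<^sub>M ?Q)"
    proof -
      have "(\<lambda>z. (\<lambda>(w, s). ?avg w s) (?W k (fst z), snd z)) \<in> borel_measurable (?N \<Otimes>\<^sub>M ?Q)"
        by measurable
      then show ?thesis by simp
    qed
    have A: "A \<in> sets (?N \<Otimes>\<^sub>M ?Q)" unfolding A_def by measurable
    have indep_now: "M.indep_var ?N ?H (PiM ?now (\<lambda>_. P)) (\<lambda>\<omega>. \<lambda>p\<in>?now. ?X p \<omega>)"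
      using k by (intro M.indep_var_restrict[OF indep]) auto
    let ?b = "\<lambda>x. \<lambda>\<tau>\<in>{1..t}. x (Suc k, \<tau>)"
    have b: "?b \<in> measurable (PiM ?now (\<lambda>_. P)) ?Q"
      by (intro measurable_restrict measurable_component_singleton) auto
    have row: "?b (\<lambda>p\<in>?now. ?X p \<omega>) = ?row \<omega>" for \<omega>
      by (auto simp: fun_eq_iff restrict_def)
    have row_law: "distr M ?Q (\<lambda>\<omega>. ?b (\<lambda>p\<in>?now. ?X p \<omega>)) = ?Q"
      unfolding row using k t0 law by (intro M.distr_sample_row[OF prob_space_axioms indep]) auto
    have row_meas: "?row \<in> measurable M ?Q"
      using measurable_compose[OF M.indep_var_rv2[OF indep_now] b] unfolding row .
    have "M.prob {\<omega> \<in> space M. (?H \<omega>, ?b (\<lambda>p\<in>?now. ?X p \<omega>)) \<in> A} \<le> \<delta>"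
    proof (rule M.prob_le_of_conditional_prob_le[OF indep_now b row_law A])
      fix x assume x: "x \<in> space ?N"
      show "measure ?Q {s \<in> space ?Q. (x, s) \<in> A} \<le> \<delta>"
      proof (cases "?gap (?W k x) \<le> \<epsilon> + e")
        case True
        then have "{s \<in> space ?Q. (x, s) \<in> A} = {s \<in> space ?Q. \<epsilon> + e / 2 < ?gap (?avg (?W k x) s)}"
          using x by (auto simp: A_def space_pair_measure)
        then show ?thesis
          using stage_failure_probability[OF G rho lip eb pos scaled(2) De scaled(1) \<delta> _ _ _ True] t
          by (simp only: scaled)
      next
        case False
        then have "{s \<in> space ?Q. (x, s) \<in> A} = {}" by (auto simp: A_def)
        then show ?thesis using \<delta> by (simp only: measure_empty less_imp_le)
      qed
    qed
    then have "M.prob {\<omega> \<in> space M. (?H \<omega>, ?row \<omega>) \<in> A} \<le> \<delta>" unfolding row .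
    moreover have "{\<omega> \<in> space M. \<epsilon> + \<epsilon>\<^sub>0 / 2 ^ Suc k < ?gap (w (Suc k) \<omega>)}
        \<subseteq> {\<omega> \<in> space M. \<epsilon> + e < ?gap (w k \<omega>)} \<union> {\<omega> \<in> space M. (?H \<omega>, ?row \<omega>) \<in> A}"
    proof (rule subsetI, rule UnCI)
      fix \<omega>
      assume "\<omega> \<in> {\<omega> \<in> space M. \<epsilon> + \<epsilon>\<^sub>0 / 2 ^ Suc k < ?gap (w (Suc k) \<omega>)}"
        and "\<omega> \<notin> {\<omega> \<in> space M. (?H \<omega>, ?row \<omega>) \<in> A}"
      then have \<omega>: "\<omega> \<in> space M" "(?H \<omega>, ?row \<omega>) \<notin> A"
        and bad: "\<epsilon> + \<epsilon>\<^sub>0 / 2 ^ Suc k < ?gap (w (Suc k) \<omega>)" by blast+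
      have "w (Suc k) \<omega> = ?avg (w k \<omega>) (\<lambda>\<tau>. \<xi> (Suc k) \<tau> \<omega>)"
        unfolding w_def proxASSG_state_Suc \<eta>_def D_def \<eta>\<^sub>1_def ..
      also have "\<dots> = ?avg (w k \<omega>) (?row \<omega>)" by (rule stage_average_cong) simp
      finally have step: "w (Suc k) \<omega> = ?avg (w k \<omega>) (?row \<omega>)" .
      have "?row \<omega> \<in> space ?Q"
        using row_meas \<omega>(1) by (rule measurable_space)
      moreover have "?H \<omega> \<in> space ?N"
        using rv[OF k(1)] \<omega>(1) by (rule measurable_space)
      ultimately have "\<not> ?gap (w k \<omega>) \<le> \<epsilon> + e"
        using \<omega>(2) bad unfolding A_def mem_Collect_eq fst_conv snd_conv W_H
        by (simp add: step e_def space_pair_measure)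
      then show "\<omega> \<in> {\<omega> \<in> space M. \<epsilon> + e < ?gap (w k \<omega>)}"
        using \<omega>(1) by simp
    qed
    moreover have "{\<omega> \<in> space M. \<epsilon> + e < ?gap (w k \<omega>)} \<in> M.events"
      using w_meas[OF k(1)] by measurable
    moreover have "{\<omega> \<in> space M. (?H \<omega>, ?row \<omega>) \<in> A} \<in> M.events"
      using rv[OF k(1)] row_meas A by measurable
    moreover have "M.prob {\<omega> \<in> space M. \<epsilon> + e < ?gap (w k \<omega>)} \<le> real k * \<delta>"
      using Suc.IH[OF k(1)] by (simp add: e_def)
    ultimately have "M.prob {\<omega> \<in> space M. \<epsilon> + \<epsilon>\<^sub>0 / 2 ^ Suc k < ?gap (w (Suc k) \<omega>)} \<le> real k * \<delta> + \<delta>"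
      by (smt (verit, best) M.finite_measure_mono measure_Un_le sets.Un)
    then show ?case by (simp add: algebra_simps)
  qed
qed

end

section \<open>The probability bound and the iteration complexity\<close>

lemma stage_count_bounds:
  assumes "0 < \<epsilon>" "\<epsilon> < \<epsilon>\<^sub>0"
  shows "1 \<le> stage_count \<epsilon>\<^sub>0 \<epsilon>" and "\<epsilon>\<^sub>0 / 2 ^ stage_count \<epsilon>\<^sub>0 \<epsilon> \<le> \<epsilon>"
    and "real (stage_count \<epsilon>\<^sub>0 \<epsilon>) \<le> 1 + log 2 (\<epsilon>\<^sub>0 / \<epsilon>)"
proof -
  have pos: "0 < log 2 (\<epsilon>\<^sub>0 / \<epsilon>)" using assms by simp
  then have ceil: "real (stage_count \<epsilon>\<^sub>0 \<epsilon>) = real_of_int \<lceil>log 2 (\<epsilon>\<^sub>0 / \<epsilon>)\<rceil>"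
    by (simp add: stage_count_def)
  show "1 \<le> stage_count \<epsilon>\<^sub>0 \<epsilon>" using pos by (simp add: stage_count_def Suc_le_eq)
  show "real (stage_count \<epsilon>\<^sub>0 \<epsilon>) \<le> 1 + log 2 (\<epsilon>\<^sub>0 / \<epsilon>)" unfolding ceil by linarith
  have "log 2 (\<epsilon>\<^sub>0 / \<epsilon>) \<le> real (stage_count \<epsilon>\<^sub>0 \<epsilon>)" unfolding ceil by linarith
  then have "\<epsilon>\<^sub>0 / \<epsilon> \<le> 2 powr real (stage_count \<epsilon>\<^sub>0 \<epsilon>)"
    using assms by (subst (asm) log_le_iff) auto
  then show "\<epsilon>\<^sub>0 / 2 ^ stage_count \<epsilon>\<^sub>0 \<epsilon> \<le> \<epsilon>"
    using assms by (simp add: powr_realpow field_simps)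
qed

lemma stage_length_bounds:
  fixes G \<rho> \<epsilon>\<^sub>0 D\<^sub>1 \<delta> :: real
  defines "x \<equiv> max (max 16 (3072 * ln (1 / \<delta>)) * (G\<^sup>2 * D\<^sub>1\<^sup>2 / \<epsilon>\<^sub>0\<^sup>2)) (8 * \<rho> * D\<^sub>1 / \<epsilon>\<^sub>0)"
  shows "x \<le> real (stage_length G \<rho> \<epsilon>\<^sub>0 D\<^sub>1 \<delta>)" and "real (stage_length G \<rho> \<epsilon>\<^sub>0 D\<^sub>1 \<delta>) \<le> x + 1"
proof -
  have len: "stage_length G \<rho> \<epsilon>\<^sub>0 D\<^sub>1 \<delta> = (LEAST n. x \<le> real n)"
    by (simp add: stage_length_def x_def)
  have "x \<le> real (nat \<lceil>x\<rceil>)" by linarith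
  then show "x \<le> real (stage_length G \<rho> \<epsilon>\<^sub>0 D\<^sub>1 \<delta>)" unfolding len by (rule LeastI)
  have "0 \<le> max 16 (3072 * ln (1 / \<delta>)) * (G\<^sup>2 * D\<^sub>1\<^sup>2 / \<epsilon>\<^sub>0\<^sup>2)" by (intro mult_nonneg_nonneg) auto
  then have "0 \<le> x" unfolding x_def by linarith
  have "stage_length G \<rho> \<epsilon>\<^sub>0 D\<^sub>1 \<delta> \<le> nat \<lceil>x\<rceil>" unfolding len
    using \<open>x \<le> real (nat \<lceil>x\<rceil>)\<close> by (rule Least_le)
  then show "real (stage_length G \<rho> \<epsilon>\<^sub>0 D\<^sub>1 \<delta>) \<le> x + 1" using \<open>0 \<le> x\<close> by linarith
qed

lemma proxASSG_high_probability:
  fixes P :: "'x measure" and f :: "'a::euclidean_space \<Rightarrow> 'x \<Rightarrow> real"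
    and c G \<rho> \<epsilon>\<^sub>0 \<epsilon> \<theta> \<delta> D\<^sub>1 :: real
  defines "K \<equiv> stage_count \<epsilon>\<^sub>0 \<epsilon>"
  defines "t \<equiv> stage_length G \<rho> \<epsilon>\<^sub>0 D\<^sub>1 (\<delta> / real K)"
  assumes pos: "0 < c" "0 < G" "0 \<le> \<rho>" "0 < \<epsilon>" "\<epsilon> < \<epsilon>\<^sub>0" "0 < \<theta>" "0 < \<delta>" "\<delta> < 1"
    and D: "c * \<epsilon>\<^sub>0 / \<epsilon> powr (1 - \<theta>) \<le> D\<^sub>1"
    and problem: "stochastic_composite_problem P f g R"
    and start: "objective P f R w\<^sub>0 - min_value (objective P f R) \<le> \<epsilon>\<^sub>0"
    and G: "\<And>w x. x \<in> space P \<Longrightarrow> norm (g w x) \<le> G"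
    and R: "\<And>w v. v \<in> subdifferential R w \<Longrightarrow> norm v \<le> \<rho>"
    and eb: "local_error_bound (objective P f R) \<epsilon> c \<theta>"
    and iid: "iid_samples M P K t \<xi>"
  shows "1 - \<delta> \<le> measure M {\<omega> \<in> space M.
    objective P f R (proxASSG g R G \<epsilon>\<^sub>0 K t w\<^sub>0 D\<^sub>1 (\<lambda>k \<tau>. \<xi> k \<tau> \<omega>))
      - min_value (objective P f R) \<le> 2 * \<epsilon>}"
proof -
  interpret stochastic_composite_problem P f g R by (rule problem)
  interpret M: prob_space M using iid by (simp add: iid_samples_def)
  let ?F = "objective P f R"
  let ?w = "\<lambda>\<omega>. proxASSG g R G \<epsilon>\<^sub>0 K t w\<^sub>0 D\<^sub>1 (\<lambda>k \<tau>. \<xi> k \<tau> \<omega>)"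
  let ?Q = "G\<^sup>2 * D\<^sub>1\<^sup>2 / \<epsilon>\<^sub>0\<^sup>2"
  have K: "1 \<le> K" "\<epsilon>\<^sub>0 / 2 ^ K \<le> \<epsilon>"
    using stage_count_bounds[of \<epsilon> \<epsilon>\<^sub>0] pos by (auto simp: K_def)
  have \<delta>: "0 < \<delta> / real K" "\<delta> / real K \<le> 1"
    using K(1) pos by (auto simp: field_simps)
  have lip: "R x - R y \<le> \<rho> * norm (x - y)" for x y
    using lipschitz_if_subgradients_bounded[OF regularizer_convex R] .
  have t: "max (max 16 (3072 * ln (1 / (\<delta> / real K))) * ?Q) (8 * \<rho> * D\<^sub>1 / \<epsilon>\<^sub>0) \<le> real t"
    unfolding t_def by (rule stage_length_bounds)
  have Q: "0 \<le> ?Q" by simp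
  have "16 * ?Q \<le> max 16 (3072 * ln (1 / (\<delta> / real K))) * ?Q"
    "3072 * ln (1 / (\<delta> / real K)) * ?Q \<le> max 16 (3072 * ln (1 / (\<delta> / real K))) * ?Q"
    by (rule mult_right_mono[OF _ Q]; simp)+
  with t have t': "16 * ?Q \<le> real t" "3072 * ln (1 / (\<delta> / real K)) * ?Q \<le> real t"
    "8 * \<rho> * D\<^sub>1 / \<epsilon>\<^sub>0 \<le> real t"
    by (auto simp del: times_divide_eq_right)
  have e0: "0 < \<epsilon>\<^sub>0" using pos by simp
  note stages = proxASSG_stages_failure_probability[OF pos(2) G pos(3) lip eb pos(4,6,1) D e0 \<delta> t' start iid order_refl,
      folded proxASSG_def]
  have [measurable]: "?F \<in> borel_measurable borel"
    by (intro borel_measurable_continuous_onI objective_continuous)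
  have [measurable]: "?w \<in> borel_measurable M" by (rule stages(1))
  have "M.prob {\<omega> \<in> space M. \<not> ?F (?w \<omega>) - min_value ?F \<le> 2 * \<epsilon>}
      \<le> M.prob {\<omega> \<in> space M. \<epsilon> + \<epsilon>\<^sub>0 / 2 ^ K < ?F (?w \<omega>) - min_value ?F}"
    using K(2) by (intro M.finite_measure_mono) auto
  also have "\<dots> \<le> real K * (\<delta> / real K)" by (rule stages(2))
  also have "\<dots> = \<delta>" using K(1) by simp
  finally have "M.prob {\<omega> \<in> space M. \<not> ?F (?w \<omega>) - min_value ?F \<le> 2 * \<epsilon>} \<le> \<delta>" .
  then show ?thesis by (subst (asm) M.prob_neg) auto
qed

text \<open>
  Put \<open>L = 1 + ln (1 / \<epsilon>)\<close>. Both \<open>K\<close> and, apart from the confidence \<open>ln (1 / \<delta>)\<close>, the logarithm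
  \<open>ln (K / \<delta>)\<close> are at most of order \<open>L\<close>; the factor \<open>K\<close> and the logarithm together give the exponent 2.
  Since \<open>D\<^sub>1 / \<epsilon>\<^sub>0\<close> is at most of order \<open>1 / r\<close> with \<open>r = \<epsilon> powr (1 - \<theta>) \<le> 1\<close>, all terms of \<open>t\<close> are at most of order
  \<open>1 / r\<^sup>2\<close>, uniformly in \<open>\<theta>\<close>.
\<close>

lemma iteration_complexity_bound:
  fixes c G \<rho> \<epsilon>\<^sub>0 C :: real
  assumes "0 < c" "0 < G" "0 \<le> \<rho>"
  obtains A where "\<And>\<epsilon> \<theta> \<delta> D\<^sub>1. \<lbrakk>0 < \<epsilon>; \<epsilon> < min 1 \<epsilon>\<^sub>0; 0 < \<theta>; \<theta> \<le> 1; 0 < \<delta>; \<delta> < 1;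
      c * \<epsilon>\<^sub>0 / \<epsilon> powr (1 - \<theta>) \<le> D\<^sub>1; D\<^sub>1 \<le> C * (c * \<epsilon>\<^sub>0 / \<epsilon> powr (1 - \<theta>))\<rbrakk> \<Longrightarrow>
    real (stage_count \<epsilon>\<^sub>0 \<epsilon> * stage_length G \<rho> \<epsilon>\<^sub>0 D\<^sub>1 (\<delta> / real (stage_count \<epsilon>\<^sub>0 \<epsilon>)))
      \<le> A * (1 + ln (1 / \<epsilon>)) ^ 2 * (max 1 (ln (1 / \<delta>)) / \<epsilon> powr (2 * (1 - \<theta>)))"
proof
  \<comment> \<open>Bounds in units of the quantities above: \<open>q\<close> for \<open>D\<^sub>1 / \<epsilon>\<^sub>0\<close>, \<open>a\<close> for \<open>K\<close>, \<open>b\<close> for the maximum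
    in \<open>t\<close>, and \<open>d\<close> for \<open>t\<close>.\<close>
  define q where "q = \<bar>C\<bar> * c"
  define a where "a = 1 + \<bar>log 2 \<epsilon>\<^sub>0\<bar> + 1 / ln 2"
  define b where "b = 16 + 3072 * (a + 1)"
  define d where "d = b * (G\<^sup>2 * q\<^sup>2) + 8 * \<rho> * q + 1"
  have q: "0 \<le> q" using assms by (simp add: q_def)
  have a: "1 \<le> a" by (simp add: a_def)
  have b: "0 \<le> b" using a by (simp add: b_def)
  have d: "0 \<le> d" using q b assms by (simp add: d_def)
  fix \<epsilon> \<theta> \<delta> D\<^sub>1 :: real
  assume \<epsilon>: "0 < \<epsilon>" "\<epsilon> < min 1 \<epsilon>\<^sub>0" and \<theta>: "0 < \<theta>" "\<theta> \<le> 1" and \<delta>: "0 < \<delta>" "\<delta> < 1"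
    and D: "c * \<epsilon>\<^sub>0 / \<epsilon> powr (1 - \<theta>) \<le> D\<^sub>1" "D\<^sub>1 \<le> C * (c * \<epsilon>\<^sub>0 / \<epsilon> powr (1 - \<theta>))"
  define L where "L = 1 + ln (1 / \<epsilon>)"
  define m where "m = max 1 (ln (1 / \<delta>))"
  define r where "r = \<epsilon> powr (1 - \<theta>)"
  define K where "K = stage_count \<epsilon>\<^sub>0 \<epsilon>"
  define t where "t = stage_length G \<rho> \<epsilon>\<^sub>0 D\<^sub>1 (\<delta> / real K)"
  have \<epsilon>\<^sub>0: "0 < \<epsilon>\<^sub>0" using \<epsilon> by simp
  have L: "1 \<le> L" using \<epsilon> by (simp add: L_def)
  have m: "1 \<le> m" "ln (1 / \<delta>) \<le> m" by (auto simp: m_def)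
  have Lm: "1 \<le> L * m" "L \<le> L * m" "m \<le> L * m"
    using L m(1) mult_mono[of 1 L 1 m] mult_left_mono[of 1 m L] mult_right_mono[of 1 L m] by auto
  have r: "0 < r" "r \<le> 1" using \<epsilon> \<theta> by (auto simp: r_def powr_le_one_le intro!: powr_le1)
  have r2: "\<epsilon> powr (2 * (1 - \<theta>)) = r\<^sup>2"
    using \<epsilon> by (simp add: r_def power2_eq_square powr_add[symmetric])
  have r2r: "0 < r\<^sup>2" "r\<^sup>2 \<le> r" "r\<^sup>2 \<le> 1"
    using r by (auto simp: power2_eq_square mult_left_le mult_le_one)
  have K: "1 \<le> K" "real K \<le> 1 + log 2 (\<epsilon>\<^sub>0 / \<epsilon>)"
    using stage_count_bounds[of \<epsilon> \<epsilon>\<^sub>0] \<epsilon> by (auto simp: K_def)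
  have KL: "real K \<le> a * L"
  proof -
    have "log 2 (\<epsilon>\<^sub>0 / \<epsilon>) = log 2 \<epsilon>\<^sub>0 + (L - 1) / ln 2"
      using \<epsilon> by (simp add: L_def log_def ln_div add_divide_distrib diff_divide_distrib)
    then have "real K \<le> 1 + \<bar>log 2 \<epsilon>\<^sub>0\<bar> + (L - 1) / ln 2" using K(2) by linarith
    also have "\<dots> \<le> (1 + \<bar>log 2 \<epsilon>\<^sub>0\<bar>) * L + (1 / ln 2) * L"
      using L mult_left_mono[of 1 L "1 + \<bar>log 2 \<epsilon>\<^sub>0\<bar>"] by (intro add_mono) (auto simp: divide_right_mono)
    finally show ?thesis by (simp add: a_def algebra_simps)
  qed
  have "0 < c * \<epsilon>\<^sub>0 / r" using assms \<epsilon>\<^sub>0 r by simp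
  then have D0: "0 < D\<^sub>1" using D by (simp add: r_def)
  have ratio: "D\<^sub>1 / \<epsilon>\<^sub>0 \<le> q / r"
  proof -
    have "D\<^sub>1 \<le> \<bar>C\<bar> * (c * \<epsilon>\<^sub>0 / r)"
      using D(2) \<open>0 < c * \<epsilon>\<^sub>0 / r\<close> unfolding r_def[symmetric]
      by (smt (verit, best) mult_right_mono)
    then show ?thesis using \<epsilon>\<^sub>0 r by (simp add: q_def field_simps)
  qed
  have log_term: "max 16 (3072 * ln (1 / (\<delta> / real K))) \<le> b * (L * m)"
  proof -
    have "ln (1 / (\<delta> / real K)) = ln (real K) + ln (1 / \<delta>)"
      using K(1) \<delta> by (simp add: ln_div)
    also have "\<dots> \<le> a * L + m"
      using KL m K(1) ln_le_minus_one[of "real K"] by simp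
    also have "\<dots> \<le> (a + 1) * (L * m)"
    proof -
      have "a * L \<le> a * (L * m)" using Lm(2) a by (intro mult_left_mono) auto
      then show ?thesis using Lm(3) unfolding distrib_right by linarith
    qed
    finally have log_le: "ln (1 / (\<delta> / real K)) \<le> (a + 1) * (L * m)" .
    have nonneg: "0 \<le> (a + 1) * (L * m)" using a Lm by simp
    have "b * (L * m) = 16 * (L * m) + 3072 * ((a + 1) * (L * m))"
      by (simp add: b_def algebra_simps)
    then show ?thesis using log_le nonneg Lm by linarith
  qed
  have "real t \<le> max (max 16 (3072 * ln (1 / (\<delta> / real K))) * (G\<^sup>2 * D\<^sub>1\<^sup>2 / \<epsilon>\<^sub>0\<^sup>2)) (8 * \<rho> * D\<^sub>1 / \<epsilon>\<^sub>0) + 1"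
    unfolding t_def by (rule stage_length_bounds)
  also have "\<dots> \<le> b * (L * m) * (G\<^sup>2 * (q\<^sup>2 / r\<^sup>2)) + 8 * \<rho> * (q / r\<^sup>2) * (L * m) + L * m / r\<^sup>2"
  proof -
    have "G\<^sup>2 * D\<^sub>1\<^sup>2 / \<epsilon>\<^sub>0\<^sup>2 \<le> G\<^sup>2 * (q\<^sup>2 / r\<^sup>2)"
      using power_mono[OF ratio, of 2] D0 \<epsilon>\<^sub>0 by (simp add: power_divide mult_left_mono flip: times_divide_eq_right)
    then have 1: "max 16 (3072 * ln (1 / (\<delta> / real K))) * (G\<^sup>2 * D\<^sub>1\<^sup>2 / \<epsilon>\<^sub>0\<^sup>2)
        \<le> b * (L * m) * (G\<^sup>2 * (q\<^sup>2 / r\<^sup>2))"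
      using log_term b Lm by (intro mult_mono) auto
    have "D\<^sub>1 / \<epsilon>\<^sub>0 \<le> q / r\<^sup>2"
      using ratio q r r2r by (smt (verit) divide_left_mono mult_pos_pos)
    then have "8 * \<rho> * (D\<^sub>1 / \<epsilon>\<^sub>0) \<le> 8 * \<rho> * (q / r\<^sup>2)"
      using assms by (intro mult_left_mono) auto
    also have "\<dots> \<le> 8 * \<rho> * (q / r\<^sup>2) * (L * m)"
      using mult_left_mono[OF Lm(1), of "8 * \<rho> * (q / r\<^sup>2)"] q assms by simp
    finally have 2: "8 * \<rho> * D\<^sub>1 / \<epsilon>\<^sub>0 \<le> 8 * \<rho> * (q / r\<^sup>2) * (L * m)" by simp
    have "1 * 1 \<le> L * m * (1 / r\<^sup>2)"
      using Lm r2r by (intro mult_mono) auto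
    moreover have "0 \<le> b * (L * m) * (G\<^sup>2 * (q\<^sup>2 / r\<^sup>2))" "0 \<le> 8 * \<rho> * (q / r\<^sup>2) * (L * m)"
      using b q Lm assms by auto
    ultimately show ?thesis using 1 2 by simp
  qed
  also have "\<dots> = d * L * (m / r\<^sup>2)"
    using r by (simp add: d_def field_simps)
  finally have t: "real t \<le> d * L * (m / r\<^sup>2)" .
  have "real (K * t) \<le> (a * L) * (d * L * (m / r\<^sup>2))"
    unfolding of_nat_mult using KL t a L by (intro mult_mono) auto
  also have "\<dots> = (a * d) * L ^ 2 * (m / r\<^sup>2)" by (simp add: power2_eq_square)
  finally show "real (stage_count \<epsilon>\<^sub>0 \<epsilon> * stage_length G \<rho> \<epsilon>\<^sub>0 D\<^sub>1 (\<delta> / real (stage_count \<epsilon>\<^sub>0 \<epsilon>)))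
      \<le> (a * d) * (1 + ln (1 / \<epsilon>)) ^ 2 * (max 1 (ln (1 / \<delta>)) / \<epsilon> powr (2 * (1 - \<theta>)))"
    unfolding K_def[symmetric] t_def[symmetric] L_def[symmetric] m_def[symmetric] r2 .
qed

theorem theorem13:
  fixes c G \<rho> \<epsilon>\<^sub>0 C :: real
  assumes "c > 0" and "G > 0" and "\<rho> \<ge> 0" and "\<epsilon>\<^sub>0 \<ge> 0"
  shows "\<exists>(A::real) (p::nat). \<forall>(\<epsilon>::real) (\<theta>::real) (\<delta>::real) (D\<^sub>1::real).
    0 < \<epsilon> \<and> \<epsilon> < min 1 \<epsilon>\<^sub>0 \<and> 0 < \<theta> \<and> \<theta> \<le> 1 \<and> 0 < \<delta> \<and> \<delta> < 1 \<and>
    D\<^sub>1 \<ge> c * \<epsilon>\<^sub>0 / \<epsilon> powr (1 - \<theta>) \<longrightarrow>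
    (let K = stage_count \<epsilon>\<^sub>0 \<epsilon>;
         t = stage_length G \<rho> \<epsilon>\<^sub>0 D\<^sub>1 (\<delta> / real K)
     in (\<forall>(P::'x measure) (f::'a::euclidean_space \<Rightarrow> 'x \<Rightarrow> real) (g::'a \<Rightarrow> 'x \<Rightarrow> 'a)
            (R::'a \<Rightarrow> real) (w\<^sub>0::'a) (M::'m measure) (\<xi>::nat \<Rightarrow> nat \<Rightarrow> 'm \<Rightarrow> 'x).
           stochastic_composite_problem P f g R \<and>
           objective P f R w\<^sub>0 - min_value (objective P f R) \<le> \<epsilon>\<^sub>0 \<and>
           (\<forall>w. \<forall>x\<in>space P. norm (g w x) \<le> G) \<and>
           (\<forall>w. \<forall>v\<in>subdifferential R w. norm v \<le> \<rho>) \<and>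
           local_error_bound (objective P f R) \<epsilon> c \<theta> \<and>
           iid_samples M P K t \<xi> \<longrightarrow>
           measure M {\<omega> \<in> space M.
             objective P f R (proxASSG g R G \<epsilon>\<^sub>0 K t w\<^sub>0 D\<^sub>1 (\<lambda>k \<tau>. \<xi> k \<tau> \<omega>))
               - min_value (objective P f R) \<le> 2 * \<epsilon>} \<ge> 1 - \<delta>) \<and>
        (D\<^sub>1 \<le> C * (c * \<epsilon>\<^sub>0 / \<epsilon> powr (1 - \<theta>)) \<longrightarrow>
           real (K * t) \<le>
             A * (1 + ln (1 / \<epsilon>)) ^ p * (max 1 (ln (1 / \<delta>)) / \<epsilon> powr (2 * (1 - \<theta>)))))"
  (is "\<exists>A p. \<forall>\<epsilon> \<theta> \<delta> D\<^sub>1. _ \<longrightarrow> ?body A p \<epsilon> \<theta> \<delta> D\<^sub>1")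
proof -
  obtain A where A: "\<And>\<epsilon> \<theta> \<delta> D\<^sub>1. \<lbrakk>0 < \<epsilon>; \<epsilon> < min 1 \<epsilon>\<^sub>0; 0 < \<theta>; \<theta> \<le> 1; 0 < \<delta>; \<delta> < 1;
      c * \<epsilon>\<^sub>0 / \<epsilon> powr (1 - \<theta>) \<le> D\<^sub>1; D\<^sub>1 \<le> C * (c * \<epsilon>\<^sub>0 / \<epsilon> powr (1 - \<theta>))\<rbrakk> \<Longrightarrow>
    real (stage_count \<epsilon>\<^sub>0 \<epsilon> * stage_length G \<rho> \<epsilon>\<^sub>0 D\<^sub>1 (\<delta> / real (stage_count \<epsilon>\<^sub>0 \<epsilon>)))
      \<le> A * (1 + ln (1 / \<epsilon>)) ^ 2 * (max 1 (ln (1 / \<delta>)) / \<epsilon> powr (2 * (1 - \<theta>)))"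
    using iteration_complexity_bound[OF \<open>c > 0\<close> \<open>G > 0\<close> \<open>\<rho> \<ge> 0\<close>, of \<epsilon>\<^sub>0 C] by blast
  show ?thesis
  proof (rule exI[of _ A], rule exI[of _ 2], intro allI impI)
    fix \<epsilon> \<theta> \<delta> D\<^sub>1 :: real
    assume H: "0 < \<epsilon> \<and> \<epsilon> < min 1 \<epsilon>\<^sub>0 \<and> 0 < \<theta> \<and> \<theta> \<le> 1 \<and> 0 < \<delta> \<and> \<delta> < 1 \<and>
      D\<^sub>1 \<ge> c * \<epsilon>\<^sub>0 / \<epsilon> powr (1 - \<theta>)"
    then have "\<epsilon> < \<epsilon>\<^sub>0" by simp
    show "?body A 2 \<epsilon> \<theta> \<delta> D\<^sub>1"
      unfolding Let_def
    proof (intro conjI allI impI, elim conjE)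
      show "real (stage_count \<epsilon>\<^sub>0 \<epsilon> * stage_length G \<rho> \<epsilon>\<^sub>0 D\<^sub>1 (\<delta> / real (stage_count \<epsilon>\<^sub>0 \<epsilon>)))
          \<le> A * (1 + ln (1 / \<epsilon>)) ^ 2 * (max 1 (ln (1 / \<delta>)) / \<epsilon> powr (2 * (1 - \<theta>)))"
        if "D\<^sub>1 \<le> C * (c * \<epsilon>\<^sub>0 / \<epsilon> powr (1 - \<theta>))"
        using H that by (intro A) auto
    next
      fix P :: "'x measure" and f :: "'a \<Rightarrow> 'x \<Rightarrow> real" and g R w\<^sub>0
        and M :: "'m measure" and \<xi>
      assume "stochastic_composite_problem P f g R"
        "objective P f R w\<^sub>0 - min_value (objective P f R) \<le> \<epsilon>\<^sub>0"
        "\<forall>w. \<forall>x\<in>space P. norm (g w x) \<le> G" "\<forall>w. \<forall>v\<in>subdifferential R w. norm v \<le> \<rho>"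
        "local_error_bound (objective P f R) \<epsilon> c \<theta>"
        "iid_samples M P (stage_count \<epsilon>\<^sub>0 \<epsilon>)
          (stage_length G \<rho> \<epsilon>\<^sub>0 D\<^sub>1 (\<delta> / real (stage_count \<epsilon>\<^sub>0 \<epsilon>))) \<xi>"
      then show "1 - \<delta> \<le> measure M {\<omega> \<in> space M.
          objective P f R (proxASSG g R G \<epsilon>\<^sub>0 (stage_count \<epsilon>\<^sub>0 \<epsilon>)
            (stage_length G \<rho> \<epsilon>\<^sub>0 D\<^sub>1 (\<delta> / real (stage_count \<epsilon>\<^sub>0 \<epsilon>))) w\<^sub>0 D\<^sub>1 (\<lambda>k \<tau>. \<xi> k \<tau> \<omega>))
          - min_value (objective P f R) \<le> 2 * \<epsilon>}"
        using H \<open>\<epsilon> < \<epsilon>\<^sub>0\<close> assms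
        by (intro proxASSG_high_probability[where c = c and \<rho> = \<rho> and \<theta> = \<theta>]) blast+
    qed
  qed
qed

end
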